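(* Let $A$ be an $n\times n$ real matrix, let $\mathbf{X}$ be a real-valued geometric $\alpha$-Hölder rough path on $[0,T]$, $\alpha\in(1/3,1/2]$, and let $\varphi_t$ be the linear flow in $\mathbb{R}^n$ of the rough differential equation $dx(t)=A\,x(t)\,d\mathbf{X}_t$. Fix a (real) canonical Jordan basis of $\mathbb{R}^n$ for $A$ (with $1$ above the diagonal), and let $d_1,\ldots,d_k$ be the sizes of the consecutive diagonal blocks, with $d_i=1$ if the corresponding eigenvalue is real and $d_i=2$ otherwise. Let $\Delta_i$ be the span of the $i$-th group of $d_i$ consecutive basis vectors. Then the cascade decomposition $$\varphi_t=\xi^1_t\circ\xi^2_t\circ\cdots\circ\xi^k_t,\qquad \xi^i_t\in\mathrm{Diff}(\Delta_i),$$ with respect to this basis has no explosion, i.e. it holds for all $t\in[0,T]$, and each $\xi^i_t$ is a linear map whose matrix in this basis coincides with the identity matrix except possibly in the $i$-th block of $d_i$ rows; that is, in this basis, $$\varphi_t=\begin{pmatrix}[\,*\ \ *\ \cdots\ *\,]_{d_1\times n}\\ \ \ I_{d_2}\\ \qquad\ddots\\ \qquad\qquad I_{d_k}\end{pmatrix}\begin{pmatrix}I_{d_1}\\ [\,*\ \ *\ \cdots\ *\,]_{d_2\times n}\\ \qquad I_{d_3}\\ \qquad\quad\ddots\\ \qquad\qquad I_{d_k}\end{pmatrix}\cdots\begin{pmatrix}I_{d_1}\\ \quad\ddots\\ \qquad I_{d_{k-1}}\\ [\,*\ \ *\ \cdots\ *\,]_{d_k\times n}\end{pmatrix}.$$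
   Context: The positive integer $k$ is the number of real eigenvalues plus the number of pairs of complex conjugate non-real eigenvalues of $A$, counted with multiplicity, so that $\sum_{i=1}^kd_i=n$. In a real canonical Jordan basis, $A$ is block upper triangular, with the $1\times1$ (real eigenvalue) and $2\times2$ (pair of conjugate non-real eigenvalues) blocks on the diagonal, and with $1$'s (respectively $2\times2$ identity blocks) above the diagonal within the Jordan blocks. Rough paths. A real-valued geometric $\alpha$-Hölder rough path on $[0,T]$, $0<T<\infty$, is a pair $\mathbf{X}=(X,\mathbb{X})$ with $X:[0,T]\to\mathbb{R}$ $\alpha$-Hölder, $\mathbb{X}$ on $\{0\le s\le t\le T\}$ $2\alpha$-Hölder, $\mathbb{X}_{st}=\mathbb{X}_{su}+\mathbb{X}_{ut}+X_{su}X_{ut}$ for $s\le u\le t$ (with $X_{st}=X_t-X_s$), and (geometric) $\mathbb{X}_{st}=\frac12X_{st}^2$. The equation is understood as $x(t)=x(0)+\int_0^tAx(r)\,d\mathbf{X}_r$ with the rough integral $\int_s^tY_r\,d\mathbf{X}_r=\lim_{|\pi|\to0}\sum_{[u,v]\in\pi}(Y_uX_{uv}+Y'_u\mathbb{X}_{uv})$, where the Gubinelli derivative $Y'$ of $Y$ is an $\alpha$-Hölder path such that $Y_{st}-Y'_sX_{st}$ is $2\alpha$-Hölder (here $Y=Ax$, $Y'=A^2x$). The flow $\varphi_t$ satisfies $\varphi_0=\mathrm{Id}$. Cascade decomposition. Each subspace $\Delta_i$ is regarded as the constant distribution on $\mathbb{R}^n$ tangent to the foliation by its translates, so $\Delta_1\oplus\cdots\oplus\Delta_k=\mathbb{R}^n$.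 $\mathrm{Diff}(\Delta_i)$ is the closure, in the group of smooth diffeomorphisms of $\mathbb{R}^n$ generated by flows of smooth vector fields, of the set of finite compositions of flows of vector fields with values in $\Delta_i$ (so its elements leave all coordinates other than those of the $i$-th block unchanged). The cascade decomposition is the unique factorization $\varphi_t=\xi^1_t\circ\cdots\circ\xi^k_t$ with $\xi^i_t\in\mathrm{Diff}(\Delta_i)$ and $\xi^i_0=\mathrm{Id}$, which in general exists only up to an explosion time. $I_d$ is the $d\times d$ identity matrix, and unmarked matrix entries are zero. *)

theory Defs
  imports "Jordan_Normal_Form.Jordan_Normal_Form" "HOL-Analysis.Analysis"
begin

section \<open>Rough paths and rough differential equations\<close>

definition holder_on :: "real \<Rightarrow> real set \<Rightarrow> (real \<Rightarrow> 'a::real_normed_vector) \<Rightarrow> bool" where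
  "holder_on \<alpha> S f \<longleftrightarrow> (\<exists>C. \<forall>s\<in>S. \<forall>t\<in>S. norm (f t - f s) \<le> C * \<bar>t - s\<bar> powr \<alpha>)"

definition holder2_on :: "real \<Rightarrow> real \<Rightarrow> (real \<Rightarrow> real \<Rightarrow> 'a::real_normed_vector) \<Rightarrow> bool" where
  "holder2_on \<beta> T F \<longleftrightarrow> (\<exists>C. \<forall>s t. 0 \<le> s \<and> s \<le> t \<and> t \<le> T \<longrightarrow> norm (F s t) \<le> C * (t - s) powr \<beta>)"

definition geometric_rough_path :: "real \<Rightarrow> real \<Rightarrow> (real \<Rightarrow> real) \<Rightarrow> (real \<Rightarrow> real \<Rightarrow> real) \<Rightarrow> bool" where
  "geometric_rough_path \<alpha> T X XX \<longleftrightarrow>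
     holder_on \<alpha> {0..T} X \<and>
     holder2_on (2 * \<alpha>) T XX \<and>
     (\<forall>s u t. 0 \<le> s \<and> s \<le> u \<and> u \<le> t \<and> t \<le> T \<longrightarrow>
        XX s t = XX s u + XX u t + (X u - X s) * (X t - X u)) \<and>
     (\<forall>s t. 0 \<le> s \<and> s \<le> t \<and> t \<le> T \<longrightarrow> XX s t = (X t - X s)\<^sup>2 / 2)"

text \<open>\<open>Y'\<close> is a Gubinelli derivative of \<open>Y\<close> with respect to \<open>X\<close>.\<close>

definition gubinelli_derivative ::
    "real \<Rightarrow> real \<Rightarrow> (real \<Rightarrow> real) \<Rightarrow> (real \<Rightarrow> 'a::real_normed_vector) \<Rightarrow> (real \<Rightarrow> 'a) \<Rightarrow> bool" where
  "gubinelli_derivative \<alpha> T X Y Y' \<longleftrightarrow>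
     holder_on \<alpha> {0..T} Y' \<and>
     holder2_on (2 * \<alpha>) T (\<lambda>s t. Y t - Y s - (X t - X s) *\<^sub>R Y' s)"

text \<open>
  The limit is taken over partitions of \<open>[s,t]\<close> with mesh tending to \<open>0\<close>. The library's
  divisions may contain one-point intervals; they contribute \<open>0\<close> to the sum because
  \<open>XX u u = 0\<close> for a rough path.
\<close>

definition has_rough_integral ::
    "(real \<Rightarrow> real) \<Rightarrow> (real \<Rightarrow> real \<Rightarrow> real) \<Rightarrow> (real \<Rightarrow> 'a::real_normed_vector) \<Rightarrow> (real \<Rightarrow> 'a)
      \<Rightarrow> real \<Rightarrow> real \<Rightarrow> 'a \<Rightarrow> bool" where
  "has_rough_integral X XX Y Y' s t I \<longleftrightarrow>
     (\<forall>\<epsilon>>0. \<exists>\<delta>>0. \<forall>\<pi>. \<pi> division_of {s..t} \<and> (\<forall>K\<in>\<pi>. Sup K - Inf K < \<delta>) \<longrightarrow>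
        norm ((\<Sum>K\<in>\<pi>. (X (Sup K) - X (Inf K)) *\<^sub>R Y (Inf K) + XX (Inf K) (Sup K) *\<^sub>R Y' (Inf K)) - I) < \<epsilon>)"

definition linear_rde_solution ::
    "real \<Rightarrow> real \<Rightarrow> (real \<Rightarrow> real) \<Rightarrow> (real \<Rightarrow> real \<Rightarrow> real) \<Rightarrow> real^'n^'n \<Rightarrow> (real \<Rightarrow> real^'n) \<Rightarrow> bool" where
  "linear_rde_solution \<alpha> T X XX A x \<longleftrightarrow>
     gubinelli_derivative \<alpha> T X (\<lambda>r. A *v x r) (\<lambda>r. (A ** A) *v x r) \<and>
     (\<forall>t\<in>{0..T}. has_rough_integral X XX (\<lambda>r. A *v x r) (\<lambda>r. (A ** A) *v x r) 0 t (x t - x 0))"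

definition linear_rde_flow ::
    "real \<Rightarrow> real \<Rightarrow> (real \<Rightarrow> real) \<Rightarrow> (real \<Rightarrow> real \<Rightarrow> real) \<Rightarrow> real^'n^'n \<Rightarrow> (real \<Rightarrow> real^'n \<Rightarrow> real^'n) \<Rightarrow> bool" where
  "linear_rde_flow \<alpha> T X XX A \<phi> \<longleftrightarrow>
     \<phi> 0 = id \<and> (\<forall>x0. linear_rde_solution \<alpha> T X XX A (\<lambda>t. \<phi> t x0))"


section \<open>Real canonical Jordan bases\<close>

definition ordered_basis :: "(nat \<Rightarrow> real^'n) \<Rightarrow> bool" where
  "ordered_basis b \<longleftrightarrow> inj_on b {..<CARD('n)} \<and> independent (b ` {..<CARD('n)}) \<and> span (b ` {..<CARD('n)}) = UNIV"

definition matrix_in_basis :: "(nat \<Rightarrow> real^'n) \<Rightarrow> (real^'n \<Rightarrow> real^'n) \<Rightarrow> real Matrix.mat" where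
  "matrix_in_basis b f = Matrix.mat CARD('n) CARD('n)
     (\<lambda>(r, c). representation (b ` {..<CARD('n)}) (f (b c)) (b r))"

text \<open>
  The real Jordan block with \<open>m\<close> diagonal blocks. A non-real \<open>\<mu>\<close> stands for the pair of \<open>\<mu>\<close> and
  its conjugate; either choice (so either sign of \<open>Im \<mu>\<close>) is allowed, which covers both
  conventions for the \<open>2 \<times> 2\<close> block.
\<close>

definition real_jordan_block :: "nat \<Rightarrow> complex \<Rightarrow> real Matrix.mat" where
  "real_jordan_block m \<mu> =
     (if \<mu> \<in> \<real> then jordan_block m (Re \<mu>)
      else Matrix.mat (2 * m) (2 * m) (\<lambda>(r, c).
        if r div 2 = c div 2 then
          (if r = c then Re \<mu> else if r < c then Im \<mu> else - Im \<mu>)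
        else if c = r + 2 then 1 else 0))"

definition real_jordan_matrix :: "(nat \<times> complex) list \<Rightarrow> real Matrix.mat" where
  "real_jordan_matrix js = diag_block_mat (map (\<lambda>(m, \<mu>). real_jordan_block m \<mu>) js)"

definition real_jordan_basis :: "real^'n^'n \<Rightarrow> (nat \<times> complex) list \<Rightarrow> (nat \<Rightarrow> real^'n) \<Rightarrow> bool" where
  "real_jordan_basis A js b \<longleftrightarrow>
     ordered_basis b \<and> (\<forall>(m, \<mu>)\<in>set js. m > 0) \<and>
     matrix_in_basis b ((*v) A) = real_jordan_matrix js"

text \<open>
  The list \<open>[d\<^sub>1, \<dots>, d\<^sub>k]\<close> of the sizes of the \<open>1 \<times> 1\<close> and \<open>2 \<times> 2\<close> diagonal blocks: one entry
  for each diagonal block, not for each Jordan block. Blocks, rows and columns are numbered from 0.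
\<close>

definition block_sizes :: "(nat \<times> complex) list \<Rightarrow> nat list" where
  "block_sizes js = concat (map (\<lambda>(m, \<mu>). replicate m (if \<mu> \<in> \<real> then 1 else 2)) js)"

definition block_rows :: "nat list \<Rightarrow> nat \<Rightarrow> nat set" where
  "block_rows ds i = {sum_list (take i ds) ..< sum_list (take (Suc i) ds)}"

definition block_subspaces :: "nat list \<Rightarrow> (nat \<Rightarrow> real^'n) \<Rightarrow> (real^'n) set list" where
  "block_subspaces ds b = map (\<lambda>i. span (b ` block_rows ds i)) [0..<length ds]"


section \<open>Diffeomorphism groups and the cascade decomposition\<close>

primrec iterated_partial ::
    "'a::euclidean_space list \<Rightarrow> ('a \<Rightarrow> 'b::real_normed_vector) \<Rightarrow> 'a \<Rightarrow> 'b" where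
  "iterated_partial [] f = f"
| "iterated_partial (u # us) f = (\<lambda>x. frechet_derivative (iterated_partial us f) (at x) u)"

definition smooth :: "('a::euclidean_space \<Rightarrow> 'b::real_normed_vector) \<Rightarrow> bool" where
  "smooth f \<longleftrightarrow> (\<forall>us x. set us \<subseteq> Basis \<longrightarrow> iterated_partial us f differentiable (at x))"

definition global_flow :: "('a::real_normed_vector \<Rightarrow> 'a) \<Rightarrow> (real \<Rightarrow> 'a \<Rightarrow> 'a) \<Rightarrow> bool" where
  "global_flow V \<Phi> \<longleftrightarrow>
     \<Phi> 0 = id \<and> (\<forall>s t. \<Phi> (s + t) = \<Phi> s \<circ> \<Phi> t) \<and>
     (\<forall>t x. ((\<lambda>\<tau>. \<Phi> \<tau> x) has_vector_derivative V (\<Phi> t x)) (at t))"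

text \<open>
  Finite compositions of flows of (complete) smooth vector fields with values in \<open>D\<close>. This set
  is a group, the inverse of \<open>\<Phi> t\<close> being \<open>\<Phi> (- t)\<close>; for \<open>D = UNIV\<close> it is the group of smooth
  diffeomorphisms generated by flows of smooth vector fields.
\<close>

inductive_set flow_compositions :: "'a::euclidean_space set \<Rightarrow> ('a \<Rightarrow> 'a) set"
  for D :: "'a set" where
  "id \<in> flow_compositions D"
| "smooth V \<Longrightarrow> range V \<subseteq> D \<Longrightarrow> global_flow V \<Phi> \<Longrightarrow> f \<in> flow_compositions D \<Longrightarrow>
     \<Phi> t \<circ> f \<in> flow_compositions D"

text \<open>
  The closure is taken with respect to uniform convergence of all partial derivatives on compact
  sets; the sets of all \<open>g\<close> satisfying the inner condition, for varying \<open>C\<close>, \<open>N\<close> and \<open>\<epsilon>\<close>, form a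
  neighbourhood base of \<open>f\<close> in this topology.
\<close>

definition Diff :: "'a::euclidean_space set \<Rightarrow> ('a \<Rightarrow> 'a) set" where
  "Diff D = {f \<in> flow_compositions UNIV.
     \<forall>C N \<epsilon>. compact C \<and> \<epsilon> > 0 \<longrightarrow>
       (\<exists>g\<in>flow_compositions D. \<forall>us. set us \<subseteq> Basis \<and> length us \<le> N \<longrightarrow>
          (\<forall>x\<in>C. norm (iterated_partial us g x - iterated_partial us f x) < \<epsilon>))}"

definition cascade_decomposition ::
    "'a::euclidean_space set list \<Rightarrow> real \<Rightarrow> (real \<Rightarrow> 'a \<Rightarrow> 'a) \<Rightarrow> (nat \<Rightarrow> real \<Rightarrow> 'a \<Rightarrow> 'a) \<Rightarrow> bool" where
  "cascade_decomposition \<Delta> \<tau> \<phi> \<xi> \<longleftrightarrow>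
     (\<forall>i<length \<Delta>. \<xi> i 0 = id) \<and>
     (\<forall>t\<in>{0..\<tau>}. (\<forall>i<length \<Delta>. \<xi> i t \<in> Diff (\<Delta> ! i)) \<and>
        \<phi> t = foldr (\<circ>) (map (\<lambda>i. \<xi> i t) [0..<length \<Delta>]) id)"

end

theory Submission
  imports Defs
begin

text \<open>
  The driving signal is one-dimensional, so the geometric rough equation obeys the chain rule and the
  flow is \<open>\<phi> t = exp ((X t - X 0) A)\<close>. Indeed, by sewing, a solution satisfies
  \<open>x t = x s + X\<^sub>s\<^sub>t A x s + (X\<^sub>s\<^sub>t\<^sup>2 / 2) A\<^sup>2 x s + O((t - s) powr (3 \<alpha>))\<close>, in which one recognises the second order
  Taylor polynomial of \<open>exp (X\<^sub>s\<^sub>t A)\<close>; hence the increments of \<open>exp (- (X t - X 0) A) x t\<close> are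
  \<open>O((t - s) powr (3 \<alpha>))\<close>, and since \<open>3 \<alpha> > 1\<close> this path is constant (\<open>linear_rde_solution_eq_exp\<close>).

  In the Jordan basis \<open>A\<close> is block upper triangular, which means that it preserves the flag
  \<open>V\<^sub>0 \<subseteq> V\<^sub>1 \<subseteq> \<dots> \<subseteq> V\<^sub>k\<close> of the subspaces \<open>V\<^sub>i = \<Delta>\<^sub>1 \<oplus> \<dots> \<oplus> \<Delta>\<^sub>i\<close>; so does every \<open>exp (s A)\<close>, and its inverse
  is of the same kind. Let \<open>P\<^sub>i\<close> be the projection on \<open>V\<^sub>i\<close> along the remaining blocks. For a linear
  isomorphism \<open>f\<close> such that \<open>f\<close> and its inverse preserve the flag, the map \<open>\<psi>\<^sub>i = P\<^sub>i + (1 - P\<^sub>i) f\<close>, which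
  applies \<open>f\<close> only in the blocks after the \<open>i\<close>-th one, is bijective: if \<open>\<psi>\<^sub>i x = 0\<close> then \<open>f x \<in> V\<^sub>i\<close>, so
  \<open>x \<in> V\<^sub>i\<close>, so \<open>x = P\<^sub>i x = 0\<close>. This is where an explosion could occur in general: the cascade would
  break down at a time at which some \<open>\<psi>\<^sub>i\<close> is singular. The factors (numbered from 1 here) are \<open>\<xi>\<^sub>i = \<psi>\<^sub>i\<^sub>-\<^sub>1 \<circ> \<psi>\<^sub>i\<^sup>-\<^sup>1\<close>; their
  product telescopes to \<open>\<psi>\<^sub>0 \<circ> \<psi>\<^sub>k\<^sup>-\<^sup>1 = f\<close>, and \<open>\<xi>\<^sub>i\<close> changes the \<open>i\<close>-th block only. Conversely, in any
  factorization of \<open>f\<close> into maps each of which changes one block only, the composition of the last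
  factors has to be the corresponding \<open>\<psi>\<^sub>i\<close>, which gives uniqueness even among nonlinear factors
  (\<open>cascade_factor_unique\<close>); elements of \<open>Diff \<Delta>\<^sub>i\<close> are such maps (\<open>Diff_moves_in_kernel\<close>).

  Finally \<open>\<xi>\<^sub>i\<close> is a composition of two flows tangent to \<open>\<Delta>\<^sub>i\<close>
  (\<open>cascade_factor_flow_in_flow_compositions\<close>): the diagonal block of \<open>exp (s A)\<close> is the exponential of
  the diagonal block of \<open>s A\<close>, because \<open>A\<close> is block triangular, and what remains of \<open>\<xi>\<^sub>i\<close> is a shear.
\<close>

section \<open>Endomorphisms as a Banach algebra and their exponential\<close>

text \<open>
  A copy of the bounded endomorphisms of a Euclidean space. Since a Euclidean space is nontrivial, the
  identity has norm \<open>1\<close>, so these form a unital Banach algebra, and the type class function \<open>exp\<close> with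
  its functional equation and its derivative becomes available for linear maps.
\<close>
typedef (overloaded) 'a endo = "UNIV :: ('a::euclidean_space \<Rightarrow>\<^sub>L 'a) set"
  morphisms blinfun_of_endo Endo
  by simp

setup_lifting type_definition_endo

instantiation endo :: (euclidean_space) real_normed_algebra_1
begin

lift_definition norm_endo :: "'a endo \<Rightarrow> real" is norm .
lift_definition minus_endo :: "'a endo \<Rightarrow> 'a endo \<Rightarrow> 'a endo" is "(-)" .
lift_definition plus_endo :: "'a endo \<Rightarrow> 'a endo \<Rightarrow> 'a endo" is "(+)" .
lift_definition uminus_endo :: "'a endo \<Rightarrow> 'a endo" is uminus .
lift_definition zero_endo :: "'a endo" is 0 .
lift_definition one_endo :: "'a endo" is id_blinfun .
lift_definition times_endo :: "'a endo \<Rightarrow> 'a endo \<Rightarrow> 'a endo" is "(o\<^sub>L)" .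
lift_definition scaleR_endo :: "real \<Rightarrow> 'a endo \<Rightarrow> 'a endo" is scaleR .

definition dist_endo :: "'a endo \<Rightarrow> 'a endo \<Rightarrow> real"
  where "dist_endo a b = norm (a - b)"
definition uniformity_endo :: "('a endo \<times> 'a endo) filter"
  where "uniformity_endo = (INF e\<in>{0 <..}. principal {(x, y). dist x y < e})"
definition open_endo :: "'a endo set \<Rightarrow> bool"
  where "open_endo S = (\<forall>x\<in>S. \<forall>\<^sub>F (x', y) in uniformity. x' = x \<longrightarrow> y \<in> S)"
definition sgn_endo :: "'a endo \<Rightarrow> 'a endo"
  where "sgn_endo x = scaleR (inverse (norm x)) x"

instance
proof
  fix a b c :: "'a endo" and r s :: real
  show "a + b + c = a + (b + c)" by transfer (simp add: add.assoc)
  show "a + b = b + a" by transfer (simp add: add.commute)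
  show "0 + a = a" by transfer simp
  show "- a + a = 0" by transfer simp
  show "a - b = a + - b" by transfer simp
  show "r *\<^sub>R (a + b) = r *\<^sub>R a + r *\<^sub>R b" by transfer (simp add: scaleR_add_right)
  show "(r + s) *\<^sub>R a = r *\<^sub>R a + s *\<^sub>R a" by transfer (simp add: scaleR_add_left)
  show "r *\<^sub>R s *\<^sub>R a = (r * s) *\<^sub>R a" by transfer simp
  show "1 *\<^sub>R a = a" by transfer simp
  show "a * b * c = a * (b * c)" by transfer (auto intro: blinfun_eqI)
  show "(a + b) * c = a * c + b * c" by transfer (rule bounded_bilinear.add_left[OF bounded_bilinear_blinfun_compose])
  show "a * (b + c) = a * b + a * c" by transfer (rule bounded_bilinear.add_right[OF bounded_bilinear_blinfun_compose])
  show "r *\<^sub>R a * b = r *\<^sub>R (a * b)" by transfer (rule bounded_bilinear.scaleR_left[OF bounded_bilinear_blinfun_compose])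
  show "a * r *\<^sub>R b = r *\<^sub>R (a * b)" by transfer (rule bounded_bilinear.scaleR_right[OF bounded_bilinear_blinfun_compose])
  show "1 * a = a" by transfer (auto intro: blinfun_eqI)
  show "a * 1 = a" by transfer (auto intro: blinfun_eqI)
  show "(0 :: 'a endo) \<noteq> 1"
  proof
    assume "(0 :: 'a endo) = 1"
    hence "(0 :: 'a \<Rightarrow>\<^sub>L 'a) = id_blinfun" by transfer
    hence "norm (id_blinfun :: 'a \<Rightarrow>\<^sub>L 'a) = 0" by simp
    thus False by simp
  qed
  show "dist a b = norm (a - b)" by (simp add: dist_endo_def)
  show "(norm a = 0) = (a = 0)" by transfer simp
  show "norm (a + b) \<le> norm a + norm b" by transfer (rule norm_triangle_ineq)
  show "norm (r *\<^sub>R a) = \<bar>r\<bar> * norm a" by transfer simp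
  show "norm (a * b) \<le> norm a * norm b" by transfer (rule norm_blinfun_compose)
  show "norm (1 :: 'a endo) = 1" by transfer simp
  show "sgn a = inverse (norm a) *\<^sub>R a" by (simp add: sgn_endo_def)
qed (simp_all add: uniformity_endo_def open_endo_def)

end

instance endo :: (euclidean_space) banach
proof
  fix X :: "nat \<Rightarrow> 'a endo"
  assume "Cauchy X"
  have norm_eq: "norm (blinfun_of_endo a - blinfun_of_endo b) = norm (a - b)" for a b :: "'a endo"
    by transfer simp
  have "Cauchy (\<lambda>n. blinfun_of_endo (X n))"
    using \<open>Cauchy X\<close> by (simp add: Cauchy_def dist_norm norm_eq)
  then obtain l where "(\<lambda>n. blinfun_of_endo (X n)) \<longlonglongrightarrow> l"
    using Cauchy_convergent_iff convergent_def by blast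
  hence "X \<longlonglongrightarrow> Endo l"
    using norm_eq[of _ "Endo l"] by (simp add: lim_sequentially dist_norm Endo_inverse)
  thus "convergent X" by (rule convergentI)
qed

lift_definition endo_apply :: "'a::euclidean_space endo \<Rightarrow> 'a \<Rightarrow> 'a" is blinfun_apply .

definition endo_of :: "('a::euclidean_space \<Rightarrow> 'a) \<Rightarrow> 'a endo"
  where "endo_of f = Endo (Blinfun f)"

lemma endo_apply_endo_of [simp]: "linear f \<Longrightarrow> endo_apply (endo_of f) = f"
  by (simp add: endo_of_def endo_apply.rep_eq Endo_inverse bounded_linear_Blinfun_apply
      linear_conv_bounded_linear)

lemma endo_eqI: "(\<And>x. endo_apply a x = endo_apply b x) \<Longrightarrow> a = b"
  by transfer (rule blinfun_eqI)

lemma endo_apply_times [simp]: "endo_apply (a * b) x = endo_apply a (endo_apply b x)"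
  by transfer simp

lemma endo_apply_one [simp]: "endo_apply 1 x = x"
  by transfer simp

lemma bounded_bilinear_endo_apply: "bounded_bilinear endo_apply"
proof
  fix a b :: "'a endo" and x y :: 'a and r :: real
  show "endo_apply (a + b) x = endo_apply a x + endo_apply b x"
    by transfer (simp add: blinfun.bilinear_simps)
  show "endo_apply a (x + y) = endo_apply a x + endo_apply a y"
    by transfer (simp add: blinfun.bilinear_simps)
  show "endo_apply (r *\<^sub>R a) x = r *\<^sub>R endo_apply a x"
    by transfer (simp add: blinfun.bilinear_simps)
  show "endo_apply a (r *\<^sub>R x) = r *\<^sub>R endo_apply a x"
    by transfer (simp add: blinfun.bilinear_simps)
  show "\<exists>K. \<forall>a x. norm (endo_apply a x) \<le> norm a * norm x * K"
    by (rule exI[of _ 1], transfer) (simp add: norm_blinfun)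
qed

interpretation endo: bounded_bilinear endo_apply
  by (rule bounded_bilinear_endo_apply)

lemma norm_endo_apply: "norm (endo_apply a x) \<le> norm a * norm x"
  by transfer (rule norm_blinfun)

lemma linear_endo_apply [simp]: "linear (endo_apply a)"
  by (rule bounded_linear.linear[OF endo.bounded_linear_right])

text \<open>
  For an idempotent \<open>p\<close> the equation \<open>a * p = p * a * p\<close> says that \<open>a\<close> maps the range of \<open>p\<close> into itself.
  It passes to the powers of \<open>a\<close> and then, multiplication being continuous, to the exponential series.
\<close>
lemma exp_invariant:
  fixes a p :: "'a::{real_normed_algebra_1, banach}"
  assumes "p * p = p" and ap: "a * p = p * a * p"
  shows "exp a * p = p * exp a * p"
proof -
  have pow: "a ^ n * p = p * a ^ n * p" for n
  proof (induction n)
    case 0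
    show ?case using \<open>p * p = p\<close> by simp
  next
    case (Suc n)
    have "a ^ Suc n * p = a * (p * a ^ n * p)"
      using Suc.IH by (metis power_Suc mult.assoc)
    also have "\<dots> = p * (a * (p * a ^ n * p))"
      using ap by (metis mult.assoc)
    also have "\<dots> = p * a ^ Suc n * p"
      using Suc.IH by (metis power_Suc mult.assoc)
    finally show ?case .
  qed
  have sums: "(\<lambda>n. a ^ n /\<^sub>R fact n) sums exp a"
    by (rule exp_converges)
  have "(\<lambda>n. p * (a ^ n /\<^sub>R fact n) * p) sums (p * exp a * p)"
    by (intro sums_mult sums_mult2 sums)
  moreover have "p * (a ^ n /\<^sub>R fact n) * p = a ^ n /\<^sub>R fact n * p" for n
    by (simp flip: pow)
  ultimately show ?thesis
    using sums_unique2 sums_mult2[OF sums, of p] by (metis (no_types, lifting) sums_cong)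
qed

lemma exp_scaleR_add:
  fixes a :: "'a::{real_normed_algebra_1, banach}"
  shows "exp ((s + t) *\<^sub>R a) = exp (s *\<^sub>R a) * exp (t *\<^sub>R a)"
  by (simp add: scaleR_add_left exp_add_commuting)

lemma exp_apply_has_vector_derivative:
  "((\<lambda>\<tau>. endo_apply (exp (\<tau> *\<^sub>R a)) x) has_vector_derivative
     endo_apply a (endo_apply (exp (t *\<^sub>R a)) x)) (at t)"
  using bounded_linear.has_vector_derivative[OF endo.bounded_linear_left
      exp_scaleR_has_vector_derivative_left[of a t]]
  by simp

section \<open>Sewing along dyadic divisions\<close>

text \<open>
  A rough integral is a limit over all divisions, so its value can be read off from the dyadic ones, and
  the recursion by halving is the one by which the sewing estimate propagates.
\<close>
primrec dyadic_division :: "nat \<Rightarrow> real \<Rightarrow> real \<Rightarrow> real set set" where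
  "dyadic_division 0 s t = {{s..t}}"
| "dyadic_division (Suc n) s t =
     dyadic_division n s ((s + t) / 2) \<union> dyadic_division n ((s + t) / 2) t"

lemma division_of_Un_adjacent:
  fixes s u t :: real
  assumes "p division_of {s..u}" "q division_of {u..t}" "s \<le> u" "u \<le> t"
  shows "p \<union> q division_of {s..t}"
proof -
  have "{s..u} \<union> {u..t} = {s..t}" using assms(3,4) by auto
  moreover have "interior {s..u} \<inter> interior {u..t} = {}" by (auto simp: interior_atLeastAtMost_real)
  ultimately show ?thesis using division_disjoint_union[OF assms(1,2)] by simp
qed

lemma dyadic_division_of:
  "s < t \<Longrightarrow> dyadic_division n s t division_of {s..t}"
proof (induction n arbitrary: s t)
  case 0
  then show ?case using division_of_self[of s t] by (simp add: cbox_interval)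
next
  case (Suc n)
  then show ?case by (auto intro!: division_of_Un_adjacent[where u = "(s + t) / 2"])
qed

lemma dyadic_division_mesh:
  "s < t \<Longrightarrow> K \<in> dyadic_division n s t \<Longrightarrow> Sup K - Inf K = (t - s) / 2 ^ n"
proof (induction n arbitrary: s t)
  case 0
  then show ?case by simp
next
  case (Suc n)
  from Suc.prems Suc.IH[of s "(s + t) / 2"] Suc.IH[of "(s + t) / 2" t] show ?case
    by (auto simp: field_simps)
qed

lemma finite_dyadic_division: "finite (dyadic_division n s t)"
  by (induction n arbitrary: s t) auto

text \<open>
  Members of a dyadic division are nondegenerate, so that no interval is shared by adjacent divisions
  and sums over them add up.
\<close>
lemma dyadic_division_disjoint:
  assumes "s < u" "u < t"
  shows "dyadic_division m s u \<inter> dyadic_division n u t = {}"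
proof (rule ccontr)
  assume "\<not> ?thesis"
  then obtain K where K: "K \<in> dyadic_division m s u" "K \<in> dyadic_division n u t" by blast
  have "K \<subseteq> {s..u}" "K \<noteq> {}"
    using division_ofD(2,3)[OF dyadic_division_of[OF \<open>s < u\<close>]] K(1) by auto
  moreover have "K \<subseteq> {u..t}"
    using division_ofD(2)[OF dyadic_division_of[OF \<open>u < t\<close>]] K(2) by auto
  ultimately have "K = {u}" by fastforce
  then have "Sup K - Inf K = 0" by simp
  with dyadic_division_mesh[OF \<open>s < u\<close> K(1)] \<open>s < u\<close> show False by simp
qed

definition division_sum :: "(real \<Rightarrow> real \<Rightarrow> 'a::comm_monoid_add) \<Rightarrow> real set set \<Rightarrow> 'a" where
  "division_sum F \<pi> = (\<Sum>K\<in>\<pi>. F (Inf K) (Sup K))"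

lemma division_sum_dyadic_Un:
  assumes "s < u" "u < t"
  shows "division_sum F (dyadic_division m s u \<union> dyadic_division n u t) =
    division_sum F (dyadic_division m s u) + division_sum F (dyadic_division n u t)"
  unfolding division_sum_def
  by (rule sum.union_disjoint) (simp_all add: finite_dyadic_division dyadic_division_disjoint assms)

text \<open>
  The constant \<open>K = C / (1 - 2 powr (1 - p))\<close> is the fixed point of the recursion
  \<open>K = 2 * (K * 2 powr (- p)) + C\<close>: halving an interval gives two errors, each smaller by the factor
  \<open>2 powr (- p)\<close>, and one new defect. It exists because \<open>p > 1\<close>.
\<close>
lemma dyadic_sewing_estimate:
  fixes F :: "real \<Rightarrow> real \<Rightarrow> 'a::real_normed_vector"
  assumes "1 < p"
    and defect: "\<And>s u t. a \<le> s \<Longrightarrow> s \<le> u \<Longrightarrow> u \<le> t \<Longrightarrow> t \<le> b \<Longrightarrow>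
      norm (F s t - F s u - F u t) \<le> C * (t - s) powr p"
    and "a \<le> s" "s < t" "t \<le> b"
  shows "norm (division_sum F (dyadic_division n s t) - F s t)
    \<le> C / (1 - 2 powr (1 - p)) * (t - s) powr p"
  using assms(3-5)
proof (induction n arbitrary: s t)
  case 0
  have "0 \<le> C * (t - s) powr p"
    using defect[of s s t] 0 by (force intro: order_trans[OF norm_ge_zero])
  then have "0 \<le> C" using 0 by (simp add: zero_le_mult_iff)
  moreover have "2 powr (1 - p) < 1" using \<open>1 < p\<close> by (simp add: powr_less_one)
  ultimately show ?case using 0 by (simp add: division_sum_def)
next
  case (Suc n)
  define K where "K = C / (1 - 2 powr (1 - p))"
  define u where "u = (s + t) / 2"
  have u: "s < u" "u < t" "u - s = (t - s) / 2" "t - u = (t - s) / 2"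
    using \<open>s < t\<close> by (simp_all add: u_def field_simps)
  let ?S = "\<lambda>s t. division_sum F (dyadic_division n s t)"
  have half: "((t - s) / 2) powr p = 2 powr (- p) * (t - s) powr p"
    using \<open>s < t\<close> by (simp add: powr_divide powr_minus field_simps)
  have "2 powr (1 - p) < 1" using \<open>1 < p\<close> by (simp add: powr_less_one)
  then have K: "2 * (K * 2 powr (- p)) + C = K"
    by (simp add: K_def field_simps powr_diff powr_minus)
  have "division_sum F (dyadic_division (Suc n) s t) - F s t =
      (?S s u - F s u) + (?S u t - F u t) - (F s t - F s u - F u t)"
    using division_sum_dyadic_Un[OF u(1,2), of F n n] by (simp add: u_def)
  also have "norm \<dots> \<le> norm (?S s u - F s u) + norm (?S u t - F u t) + norm (F s t - F s u - F u t)"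
    by (intro order_trans[OF norm_triangle_ineq4] add_mono norm_triangle_ineq order_refl)
  also have "\<dots> \<le> K * ((t - s) / 2) powr p + K * ((t - s) / 2) powr p + C * (t - s) powr p"
    using Suc.IH[of s u] Suc.IH[of u t] defect[of s u t] Suc.prems u
    by (intro add_mono) (auto simp: K_def)
  also have "\<dots> = (2 * (K * 2 powr (- p)) + C) * (t - s) powr p"
    unfolding half by (simp add: algebra_simps)
  also have "\<dots> = K * (t - s) powr p"
    unfolding K ..
  finally show ?case by (simp add: K_def)
qed

text \<open>The local approximation of the rough integral over \<open>[s, t]\<close>.\<close>
definition rough_germ ::
    "(real \<Rightarrow> real) \<Rightarrow> (real \<Rightarrow> real \<Rightarrow> real) \<Rightarrow> (real \<Rightarrow> 'a::real_normed_vector) \<Rightarrow> (real \<Rightarrow> 'a)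
      \<Rightarrow> real \<Rightarrow> real \<Rightarrow> 'a" where
  "rough_germ X XX Y Y' s t = (X t - X s) *\<^sub>R Y s + XX s t *\<^sub>R Y' s"

lemma has_rough_integral_tendsto:
  assumes I: "has_rough_integral X XX Y Y' s t I"
    and div: "\<And>n. \<pi> n division_of {s..t}"
    and mesh: "\<And>n K. K \<in> \<pi> n \<Longrightarrow> Sup K - Inf K \<le> c / 2 ^ n"
  shows "(\<lambda>n. division_sum (rough_germ X XX Y Y') (\<pi> n)) \<longlonglongrightarrow> I"
proof (rule tendstoI)
  fix e :: real assume "0 < e"
  then obtain \<delta> where "\<delta> > 0" and \<delta>: "\<And>\<pi>. \<pi> division_of {s..t} \<Longrightarrow> (\<forall>K\<in>\<pi>. Sup K - Inf K < \<delta>) \<Longrightarrow>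
      norm ((\<Sum>K\<in>\<pi>. (X (Sup K) - X (Inf K)) *\<^sub>R Y (Inf K) + XX (Inf K) (Sup K) *\<^sub>R Y' (Inf K)) - I) < e"
    using I unfolding has_rough_integral_def by meson
  have "(\<lambda>n. c / 2 ^ n) \<longlonglongrightarrow> 0"
    by (rule LIMSEQ_divide_realpow_zero) simp
  then have "\<forall>\<^sub>F n in sequentially. c / 2 ^ n < \<delta>"
    using \<open>\<delta> > 0\<close> by (rule order_tendstoD)
  then show "\<forall>\<^sub>F n in sequentially. dist (division_sum (rough_germ X XX Y Y') (\<pi> n)) I < e"
  proof eventually_elim
    case (elim n)
    then show ?case
      using \<delta>[OF div[of n]] mesh[of _ n] by (force simp: division_sum_def rough_germ_def dist_norm)
  qed
qed

text \<open>
  The equation only speaks of integrals from a fixed initial time. The integral over \<open>[s, t]\<close> is recovered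
  by subtracting the sums over \<open>[a, s]\<close> from those over the union of the two divisions. In the case
  \<open>a = s\<close> there is no division of \<open>[a, s]\<close> to subtract.
\<close>
lemma dyadic_sums_tendsto_increment:
  assumes 0: "has_rough_integral X XX Y Y' a s I" and 1: "has_rough_integral X XX Y Y' a t J"
    and I0: "a = s \<Longrightarrow> I = 0" and "a \<le> s" "s < t"
  shows "(\<lambda>n. division_sum (rough_germ X XX Y Y') (dyadic_division n s t)) \<longlonglongrightarrow> J - I"
proof (cases "a = s")
  case True
  then show ?thesis
    using has_rough_integral_tendsto[OF 1, of "\<lambda>n. dyadic_division n s t" "t - s"] I0 \<open>s < t\<close>
    by (simp add: dyadic_division_of dyadic_division_mesh)
next
  case False
  then have "a < s" using \<open>a \<le> s\<close> by simp
  let ?S = "division_sum (rough_germ X XX Y Y')"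
  have "(\<lambda>n. ?S (dyadic_division n a s)) \<longlonglongrightarrow> I"
    using has_rough_integral_tendsto[OF 0, of "\<lambda>n. dyadic_division n a s" "s - a"] \<open>a < s\<close>
    by (simp add: dyadic_division_of dyadic_division_mesh)
  moreover have "(\<lambda>n. ?S (dyadic_division n a s \<union> dyadic_division n s t)) \<longlonglongrightarrow> J"
  proof (rule has_rough_integral_tendsto[OF 1])
    show "dyadic_division n a s \<union> dyadic_division n s t division_of {a..t}" for n
      using \<open>a < s\<close> \<open>s < t\<close> by (intro division_of_Un_adjacent[where u = s] dyadic_division_of) auto
    show "Sup K - Inf K \<le> (t - a) / 2 ^ n"
      if "K \<in> dyadic_division n a s \<union> dyadic_division n s t" for n K
      using that dyadic_division_mesh[OF \<open>a < s\<close>, of K n] dyadic_division_mesh[OF \<open>s < t\<close>, of K n]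
        \<open>a < s\<close> \<open>s < t\<close> by (auto intro!: divide_right_mono)
  qed
  ultimately have "(\<lambda>n. ?S (dyadic_division n a s \<union> dyadic_division n s t) - ?S (dyadic_division n a s))
      \<longlonglongrightarrow> J - I"
    by (rule tendsto_diff[rotated])
  then show ?thesis
    using \<open>a < s\<close> \<open>s < t\<close> by (simp add: division_sum_dyadic_Un)
qed

lemma holder_onE:
  assumes "holder_on \<alpha> {0..T} f"
  obtains C where "0 \<le> C"
    "\<And>s t. 0 \<le> s \<Longrightarrow> s \<le> t \<Longrightarrow> t \<le> T \<Longrightarrow> norm (f t - f s) \<le> C * (t - s) powr \<alpha>"
proof -
  from assms obtain C where C: "\<And>s t. s \<in> {0..T} \<Longrightarrow> t \<in> {0..T} \<Longrightarrow> norm (f t - f s) \<le> C * \<bar>t - s\<bar> powr \<alpha>"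
    unfolding holder_on_def by blast
  show thesis
  proof
    fix s t :: real assume "0 \<le> s" "s \<le> t" "t \<le> T"
    then have "norm (f t - f s) \<le> C * (t - s) powr \<alpha>" using C[of s t] by simp
    also have "\<dots> \<le> \<bar>C\<bar> * (t - s) powr \<alpha>" by (intro mult_right_mono) auto
    finally show "norm (f t - f s) \<le> \<bar>C\<bar> * (t - s) powr \<alpha>" .
  qed simp
qed

lemma holder2_onE:
  assumes "holder2_on \<beta> T F"
  obtains C where "0 \<le> C"
    "\<And>s t. 0 \<le> s \<Longrightarrow> s \<le> t \<Longrightarrow> t \<le> T \<Longrightarrow> norm (F s t) \<le> C * (t - s) powr \<beta>"
proof -
  from assms obtain C where C: "\<And>s t. 0 \<le> s \<and> s \<le> t \<and> t \<le> T \<Longrightarrow> norm (F s t) \<le> C * (t - s) powr \<beta>"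
    unfolding holder2_on_def by blast
  show thesis
  proof
    fix s t :: real assume "0 \<le> s" "s \<le> t" "t \<le> T"
    then have "norm (F s t) \<le> C * (t - s) powr \<beta>" using C[of s t] by simp
    also have "\<dots> \<le> \<bar>C\<bar> * (t - s) powr \<beta>" by (intro mult_right_mono) auto
    finally show "norm (F s t) \<le> \<bar>C\<bar> * (t - s) powr \<beta>" .
  qed simp
qed

text \<open>
  By Chen's relation the defect equals
  \<open>- (X t - X u) (Y u - Y s - (X u - X s) Y' s) - XX u t (Y' u - Y' s)\<close>, and both terms are of order
  \<open>\<alpha> + 2 * \<alpha>\<close>.
\<close>
lemma rough_germ_defect:
  assumes rp: "geometric_rough_path \<alpha> T X XX" and Y: "gubinelli_derivative \<alpha> T X Y Y'"
    and "0 \<le> \<alpha>"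
  obtains C where "\<And>s u t. 0 \<le> s \<Longrightarrow> s \<le> u \<Longrightarrow> u \<le> t \<Longrightarrow> t \<le> T \<Longrightarrow>
    norm (rough_germ X XX Y Y' s t - rough_germ X XX Y Y' s u - rough_germ X XX Y Y' u t)
      \<le> C * (t - s) powr (3 * \<alpha>)"
proof -
  define R where "R = (\<lambda>s t. Y t - Y s - (X t - X s) *\<^sub>R Y' s)"
  from rp have hX: "holder_on \<alpha> {0..T} X" and hXX: "holder2_on (2 * \<alpha>) T XX"
    and chen: "\<And>s u t. 0 \<le> s \<Longrightarrow> s \<le> u \<Longrightarrow> u \<le> t \<Longrightarrow> t \<le> T \<Longrightarrow>
      XX s t = XX s u + XX u t + (X u - X s) * (X t - X u)"
    unfolding geometric_rough_path_def by auto
  from Y have hY': "holder_on \<alpha> {0..T} Y'" and hR: "holder2_on (2 * \<alpha>) T R"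
    unfolding gubinelli_derivative_def R_def by auto
  from hX obtain C1 where C1: "0 \<le> C1"
    and X1: "\<And>s t. 0 \<le> s \<Longrightarrow> s \<le> t \<Longrightarrow> t \<le> T \<Longrightarrow> norm (X t - X s) \<le> C1 * (t - s) powr \<alpha>"
    by (rule holder_onE) blast
  from hXX obtain C2 where C2: "0 \<le> C2"
    and X2: "\<And>s t. 0 \<le> s \<Longrightarrow> s \<le> t \<Longrightarrow> t \<le> T \<Longrightarrow> norm (XX s t) \<le> C2 * (t - s) powr (2 * \<alpha>)"
    by (rule holder2_onE) blast
  from hY' obtain C3 where C3: "0 \<le> C3"
    and Y1: "\<And>s t. 0 \<le> s \<Longrightarrow> s \<le> t \<Longrightarrow> t \<le> T \<Longrightarrow> norm (Y' t - Y' s) \<le> C3 * (t - s) powr \<alpha>"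
    by (rule holder_onE) blast
  from hR obtain C4 where C4: "0 \<le> C4"
    and Y2: "\<And>s t. 0 \<le> s \<Longrightarrow> s \<le> t \<Longrightarrow> t \<le> T \<Longrightarrow> norm (R s t) \<le> C4 * (t - s) powr (2 * \<alpha>)"
    by (rule holder2_onE) blast
  note C = C1 C2 C3 C4
  show thesis
  proof
    fix s u t :: real assume st: "0 \<le> s" "s \<le> u" "u \<le> t" "t \<le> T"
    let ?d = "t - s"
    have mono: "(b - a) powr \<beta> \<le> ?d powr \<beta>" if "0 \<le> \<beta>" "s \<le> a" "a \<le> b" "b \<le> t" for a b \<beta>
      using that by (intro powr_mono2) auto
    have X1': "\<bar>X t - X u\<bar> \<le> C1 * ?d powr \<alpha>"
      using order_trans[OF X1[of u t] mult_left_mono[OF mono[of \<alpha> u t]]] st C \<open>0 \<le> \<alpha>\<close> by simp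
    have X2': "\<bar>XX u t\<bar> \<le> C2 * ?d powr (2 * \<alpha>)"
      using order_trans[OF X2[of u t] mult_left_mono[OF mono[of "2 * \<alpha>" u t]]] st C \<open>0 \<le> \<alpha>\<close> by simp
    have Y1': "norm (Y' u - Y' s) \<le> C3 * ?d powr \<alpha>"
      using order_trans[OF Y1[of s u] mult_left_mono[OF mono[of \<alpha> s u]]] st C \<open>0 \<le> \<alpha>\<close> by simp
    have Y2': "norm (R s u) \<le> C4 * ?d powr (2 * \<alpha>)"
      using order_trans[OF Y2[of s u] mult_left_mono[OF mono[of "2 * \<alpha>" s u]]] st C \<open>0 \<le> \<alpha>\<close> by simp
    have "rough_germ X XX Y Y' s t - rough_germ X XX Y Y' s u - rough_germ X XX Y Y' u t =
        - ((X t - X u) *\<^sub>R R s u) - XX u t *\<^sub>R (Y' u - Y' s)"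
      unfolding rough_germ_def R_def chen[OF st] by (simp add: algebra_simps)
    also have "norm \<dots> \<le> \<bar>X t - X u\<bar> * norm (R s u) + \<bar>XX u t\<bar> * norm (Y' u - Y' s)"
      by (rule order_trans[OF norm_triangle_ineq4]) simp
    also have "\<dots> \<le> (C1 * ?d powr \<alpha>) * (C4 * ?d powr (2 * \<alpha>)) + (C2 * ?d powr (2 * \<alpha>)) * (C3 * ?d powr \<alpha>)"
      using C by (intro add_mono mult_mono X1' X2' Y1' Y2') auto
    also have "\<dots> = (C1 * C4 + C2 * C3) * (?d powr \<alpha> * ?d powr (2 * \<alpha>))"
      by (simp add: algebra_simps)
    also have "?d powr \<alpha> * ?d powr (2 * \<alpha>) = ?d powr (3 * \<alpha>)"
      by (simp flip: powr_add)
    finally show "norm (rough_germ X XX Y Y' s t - rough_germ X XX Y Y' s u - rough_germ X XX Y Y' u t)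
        \<le> (C1 * C4 + C2 * C3) * ?d powr (3 * \<alpha>)" .
  qed
qed

lemma rough_integral_increment_estimate:
  assumes rp: "geometric_rough_path \<alpha> T X XX" and Y: "gubinelli_derivative \<alpha> T X Y Y'"
    and "1/3 < \<alpha>"
    and int: "\<And>t. t \<in> {0..T} \<Longrightarrow> has_rough_integral X XX Y Y' 0 t (x t - x 0)"
  obtains K where "0 \<le> K" "\<And>s t. 0 \<le> s \<Longrightarrow> s \<le> t \<Longrightarrow> t \<le> T \<Longrightarrow>
    norm (x t - x s - rough_germ X XX Y Y' s t) \<le> K * (t - s) powr (3 * \<alpha>)"
proof -
  let ?F = "rough_germ X XX Y Y'"
  from rough_germ_defect[OF rp Y] \<open>1/3 < \<alpha>\<close>
  obtain C where C: "\<And>s u t. 0 \<le> s \<Longrightarrow> s \<le> u \<Longrightarrow> u \<le> t \<Longrightarrow> t \<le> T \<Longrightarrow>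
    norm (?F s t - ?F s u - ?F u t) \<le> C * (t - s) powr (3 * \<alpha>)" by auto
  define K where "K = C / (1 - 2 powr (1 - 3 * \<alpha>))"
  have K: "norm (x t - x s - ?F s t) \<le> K * (t - s) powr (3 * \<alpha>)" if st: "0 \<le> s" "s < t" "t \<le> T" for s t
  proof (rule tendsto_upperbound)
    have "(\<lambda>n. division_sum ?F (dyadic_division n s t)) \<longlonglongrightarrow> (x t - x 0) - (x s - x 0)"
      using st by (intro dyadic_sums_tendsto_increment[of _ _ _ _ 0] int) auto
    then show "(\<lambda>n. norm (division_sum ?F (dyadic_division n s t) - ?F s t)) \<longlonglongrightarrow> norm (x t - x s - ?F s t)"
      by (intro tendsto_intros) simp
    show "\<forall>\<^sub>F n in sequentially.
        norm (division_sum ?F (dyadic_division n s t) - ?F s t) \<le> K * (t - s) powr (3 * \<alpha>)"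
      unfolding K_def using st \<open>1/3 < \<alpha>\<close>
      by (intro always_eventually allI dyadic_sewing_estimate[of _ 0 T]) (auto intro: C)
  qed simp
  show thesis
  proof
    fix s t :: real assume st: "0 \<le> s" "s \<le> t" "t \<le> T"
    show "norm (x t - x s - ?F s t) \<le> \<bar>K\<bar> * (t - s) powr (3 * \<alpha>)"
    proof (cases "s = t")
      case True
      have "XX t t = (X t - X t)\<^sup>2 / 2"
        using rp st True unfolding geometric_rough_path_def by blast
      then show ?thesis using True by (simp add: rough_germ_def)
    next
      case False
      then have "norm (x t - x s - ?F s t) \<le> K * (t - s) powr (3 * \<alpha>)" using K[of s t] st by simp
      also have "\<dots> \<le> \<bar>K\<bar> * (t - s) powr (3 * \<alpha>)" by (intro mult_right_mono) auto
      finally show ?thesis .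
    qed
  qed simp
qed

section \<open>Solutions of the linear rough equation\<close>

text \<open>
  Such a function is differentiable with derivative \<open>0\<close>.
\<close>
lemma constant_if_superlinear_increments:
  fixes f :: "real \<Rightarrow> 'a::real_normed_vector"
  assumes "1 < p"
    and incr: "\<And>s t. a \<le> s \<Longrightarrow> s \<le> t \<Longrightarrow> t \<le> b \<Longrightarrow> norm (f t - f s) \<le> C * (t - s) powr p"
    and t: "t \<in> {a..b}"
  shows "f t = f a"
proof -
  have abs_incr: "norm (f y - f x) \<le> C * \<bar>y - x\<bar> powr p" if "x \<in> {a..b}" "y \<in> {a..b}" for x y
    using incr[of x y] incr[of y x] that by (cases "x \<le> y") (auto simp: norm_minus_commute)
  have "(f has_derivative (\<lambda>_. 0)) (at x within {a..b})" if x: "x \<in> {a..b}" for x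
  proof (rule has_derivativeI_sandwich[of 1 _ _ _ _ "\<lambda>y. C * \<bar>y - x\<bar> powr (p - 1)"])
    show "((\<lambda>y. C * \<bar>y - x\<bar> powr (p - 1)) \<longlongrightarrow> 0) (at x within {a..b})"
      using \<open>1 < p\<close> by (auto intro!: tendsto_eq_intros)
    fix y assume y: "y \<in> {a..b}" "y \<noteq> x" "dist y x < 1"
    have "norm (f y - f x) \<le> C * \<bar>y - x\<bar> powr p" using abs_incr x y by blast
    also have "\<bar>y - x\<bar> powr p = \<bar>y - x\<bar> powr (p - 1) * \<bar>y - x\<bar>"
      using y(2) by (simp add: powr_diff)
    finally show "norm (f y - f x - 0) / norm (y - x) \<le> C * \<bar>y - x\<bar> powr (p - 1)"
      using y(2) by (simp add: divide_le_eq mult.assoc)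
  qed simp_all
  then obtain c where "\<And>x. x \<in> {a..b} \<Longrightarrow> f x = c"
    using has_derivative_zero_constant[of "{a..b}" f] by auto
  then show ?thesis using t by (metis atLeastAtMost_iff order_refl order_trans)
qed

text \<open>
  The function \<open>g r = exp (- r L) (v + r L v + r\<^sup>2/2 L\<^sup>2 v)\<close> has the derivative
  \<open>- r\<^sup>2/2 exp (- r L) L\<^sup>3 v\<close>, since all other terms cancel; the mean value inequality on
  \<open>[- \<bar>h\<bar>, \<bar>h\<bar>]\<close> gives the bound.
\<close>
lemma exp_taylor2_inverse_bound:
  "norm (endo_apply (exp (- h *\<^sub>R L)) (v + h *\<^sub>R endo_apply L v + (h\<^sup>2 / 2) *\<^sub>R endo_apply L (endo_apply L v)) - v)
    \<le> exp (\<bar>h\<bar> * norm L) * norm L ^ 3 * norm v * \<bar>h\<bar> ^ 3"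
proof -
  define B where "B = exp (\<bar>h\<bar> * norm L) * norm L ^ 3 * norm v * \<bar>h\<bar>\<^sup>2"
  define g where "g = (\<lambda>r. endo_apply (exp (r *\<^sub>R (- L))) v + r *\<^sub>R endo_apply (exp (r *\<^sub>R (- L))) (endo_apply L v)
    + (r\<^sup>2 / 2) *\<^sub>R endo_apply (exp (r *\<^sub>R (- L))) (endo_apply L (endo_apply L v)))"
  define L3 where "L3 = endo_apply L (endo_apply L (endo_apply L v))"
  have comm: "endo_apply L (endo_apply (exp (r *\<^sub>R (- L))) w) = endo_apply (exp (r *\<^sub>R (- L))) (endo_apply L w)" for r w
  proof -
    have "L * exp (r *\<^sub>R (- L)) = exp (r *\<^sub>R (- L)) * L"
      using exp_times_scaleR_commute[of r "- L"] by simp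
    then show ?thesis by (metis endo_apply_times)
  qed
  have deriv: "(g has_vector_derivative (- (r\<^sup>2 / 2)) *\<^sub>R endo_apply (exp (r *\<^sub>R (- L))) L3) (at r)" for r
    unfolding g_def
    by (rule derivative_eq_intros exp_apply_has_vector_derivative refl | simp)+
      (simp add: endo.minus_left comm[simplified] L3_def algebra_simps)
  have bound: "norm ((- (r\<^sup>2 / 2)) *\<^sub>R endo_apply (exp (r *\<^sub>R (- L))) L3) \<le> B" if "\<bar>r\<bar> \<le> \<bar>h\<bar>" for r
  proof -
    have "norm (endo_apply (exp (r *\<^sub>R (- L))) L3) \<le> norm (exp (r *\<^sub>R (- L))) * norm L3"
      by (rule norm_endo_apply)
    also have "\<dots> \<le> exp (\<bar>h\<bar> * norm L) * (norm L ^ 3 * norm v)"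
    proof (rule mult_mono)
      show "norm (exp (r *\<^sub>R (- L))) \<le> exp (\<bar>h\<bar> * norm L)"
        using that by (intro order_trans[OF norm_exp]) (simp add: mult_right_mono)
      have "norm L3 = norm (endo_apply (L * L * L) v)" by (simp add: L3_def)
      also have "\<dots> \<le> norm (L * L * L) * norm v" by (rule norm_endo_apply)
      also have "norm (L * L * L) \<le> norm L * norm L * norm L"
        by (intro order_trans[OF norm_mult_ineq] mult_right_mono norm_mult_ineq norm_ge_zero)
      finally show "norm L3 \<le> norm L ^ 3 * norm v" by (simp add: power3_eq_cube mult_right_mono)
    qed simp_all
    finally have "norm (endo_apply (exp (r *\<^sub>R (- L))) L3) \<le> exp (\<bar>h\<bar> * norm L) * (norm L ^ 3 * norm v)" .
    moreover have "r\<^sup>2 \<le> \<bar>h\<bar>\<^sup>2"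
      using that by (simp add: abs_le_square_iff)
    then have "r\<^sup>2 / 2 \<le> \<bar>h\<bar>\<^sup>2"
      using zero_le_power2[of r] by linarith
    ultimately have "r\<^sup>2 / 2 * norm (endo_apply (exp (r *\<^sub>R (- L))) L3) \<le>
        \<bar>h\<bar>\<^sup>2 * (exp (\<bar>h\<bar> * norm L) * (norm L ^ 3 * norm v))"
      by (intro mult_mono) auto
    then show ?thesis by (simp add: B_def mult_ac)
  qed
  have "norm (g h - g 0) \<le> B * norm (h - 0)"
  proof (rule differentiable_bound)
    show "convex {-\<bar>h\<bar>..\<bar>h\<bar>}" by simp
    fix r assume r: "r \<in> {-\<bar>h\<bar>..\<bar>h\<bar>}"
    show "(g has_derivative (\<lambda>c. c *\<^sub>R ((- (r\<^sup>2 / 2)) *\<^sub>R endo_apply (exp (r *\<^sub>R (- L))) L3)))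
        (at r within {-\<bar>h\<bar>..\<bar>h\<bar>})"
      using deriv[of r] unfolding has_vector_derivative_def by (rule has_derivative_at_withinI)
    show "onorm (\<lambda>c. c *\<^sub>R ((- (r\<^sup>2 / 2)) *\<^sub>R endo_apply (exp (r *\<^sub>R (- L))) L3)) \<le> B"
      using bound[of r] r by (subst onorm_scaleR_left) (auto simp: onorm_id)
  qed auto
  moreover have "g h - g 0 = endo_apply (exp (- h *\<^sub>R L))
      (v + h *\<^sub>R endo_apply L v + (h\<^sup>2 / 2) *\<^sub>R endo_apply L (endo_apply L v)) - v"
    by (simp add: g_def endo.add_right endo.scaleR_right)
  ultimately show ?thesis by (simp add: B_def power2_eq_square power3_eq_cube mult_ac)
qed

text \<open>
  On an interval \<open>[s, t]\<close> put \<open>h = X t - X s\<close>. As \<open>XX s t = h\<^sup>2/2\<close>, the germ of the equation added to \<open>x s\<close>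
  is the second order Taylor polynomial of \<open>exp (h L) (x s)\<close>. Undoing the flow by \<open>exp (- h L)\<close> leaves an
  error of order \<open>\<bar>h\<bar> ^ 3\<close>, that is, of order \<open>3 * \<alpha> > 1\<close>, like the sewing error. Hence
  \<open>y t = exp (- (X t - X 0) L) (x t)\<close> is constant. For uniform constants the solution has to be bounded,
  which follows from the same increment estimate on \<open>[0, t]\<close>.
\<close>
lemma linear_rde_solution_eq_exp:
  fixes A :: "real^'n^'n"
  assumes "1/3 < \<alpha>" and rp: "geometric_rough_path \<alpha> T X XX"
    and sol: "linear_rde_solution \<alpha> T X XX A x" and t: "t \<in> {0..T}"
  shows "x t = endo_apply (exp ((X t - X 0) *\<^sub>R endo_of ((*v) A))) (x 0)"
proof -
  define L where "L = endo_of ((*v) A)"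
  have L: "A *v v = endo_apply L v" for v by (simp add: L_def)
  have L2: "(A ** A) *v v = endo_apply L (endo_apply L v)" for v
    by (simp add: L flip: matrix_vector_mul_assoc)
  let ?F = "rough_germ X XX (\<lambda>r. A *v x r) (\<lambda>r. (A ** A) *v x r)"
  from sol have gub: "gubinelli_derivative \<alpha> T X (\<lambda>r. A *v x r) (\<lambda>r. (A ** A) *v x r)"
    and int: "\<And>t. t \<in> {0..T} \<Longrightarrow> has_rough_integral X XX (\<lambda>r. A *v x r) (\<lambda>r. (A ** A) *v x r) 0 t (x t - x 0)"
    unfolding linear_rde_solution_def by auto
  obtain K where "0 \<le> K" and K: "\<And>s t. 0 \<le> s \<Longrightarrow> s \<le> t \<Longrightarrow> t \<le> T \<Longrightarrow>
      norm (x t - x s - ?F s t) \<le> K * (t - s) powr (3 * \<alpha>)"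
    by (rule rough_integral_increment_estimate[OF rp gub \<open>1/3 < \<alpha>\<close> int]) simp_all
  from rp have hX: "holder_on \<alpha> {0..T} X" unfolding geometric_rough_path_def by blast
  obtain CX where "0 \<le> CX"
    and CX: "\<And>s t. 0 \<le> s \<Longrightarrow> s \<le> t \<Longrightarrow> t \<le> T \<Longrightarrow> norm (X t - X s) \<le> CX * (t - s) powr \<alpha>"
    using hX by (rule holder_onE) blast
  have F: "?F s t = (X t - X s) *\<^sub>R endo_apply L (x s) + ((X t - X s)\<^sup>2 / 2) *\<^sub>R endo_apply L (endo_apply L (x s))"
    if "0 \<le> s" "s \<le> t" "t \<le> T" for s t
    using rp that unfolding geometric_rough_path_def by (simp add: rough_germ_def L L2)
  define H where "H = CX * T powr \<alpha>"
  have H: "\<bar>X t - X s\<bar> \<le> H" if "0 \<le> s" "s \<le> t" "t \<le> T" for s t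
  proof -
    have "(t - s) powr \<alpha> \<le> T powr \<alpha>" using that \<open>1/3 < \<alpha>\<close> by (intro powr_mono2) auto
    then have "CX * (t - s) powr \<alpha> \<le> H"
      unfolding H_def using \<open>0 \<le> CX\<close> by (rule mult_left_mono)
    then show ?thesis using CX[OF that] by simp
  qed
  define E where "E = exp (H * norm L)"
  have E: "norm (exp ((- (X t - X s)) *\<^sub>R L)) \<le> E" if "0 \<le> s" "s \<le> t" "t \<le> T" for s t
    unfolding E_def using H[OF that]
    by (intro order_trans[OF norm_exp]) (simp add: mult_right_mono)
  define M where "M = norm (x 0) + (H * norm (endo_apply L (x 0)) + H\<^sup>2 * norm (endo_apply L (endo_apply L (x 0)))) + K * T powr (3 * \<alpha>)"
  have M: "norm (x t) \<le> M" if t: "0 \<le> t" "t \<le> T" for t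
  proof -
    have "x t = x 0 + ?F 0 t + (x t - x 0 - ?F 0 t)" by simp
    then have "norm (x t) \<le> norm (x 0) + norm (?F 0 t) + norm (x t - x 0 - ?F 0 t)"
      by (metis order_trans[OF norm_triangle_ineq add_right_mono[OF norm_triangle_ineq]])
    also have "norm (?F 0 t) \<le> \<bar>X t - X 0\<bar> * norm (endo_apply L (x 0)) +
        (X t - X 0)\<^sup>2 / 2 * norm (endo_apply L (endo_apply L (x 0)))"
      unfolding F[OF order_refl t] by (rule order_trans[OF norm_triangle_ineq]) simp
    also have "\<dots> \<le> H * norm (endo_apply L (x 0)) + H\<^sup>2 * norm (endo_apply L (endo_apply L (x 0)))"
    proof (intro add_mono mult_right_mono)
      show "\<bar>X t - X 0\<bar> \<le> H" by (rule H) (use t in auto)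
      then have "(X t - X 0)\<^sup>2 \<le> H\<^sup>2" by (metis abs_ge_zero power2_abs power_mono)
      then show "(X t - X 0)\<^sup>2 / 2 \<le> H\<^sup>2" using zero_le_power2[of "X t - X 0"] by linarith
    qed auto
    also have "norm (x t - x 0 - ?F 0 t) \<le> K * T powr (3 * \<alpha>)"
      using t \<open>0 \<le> K\<close> \<open>1/3 < \<alpha>\<close>
      by (intro order_trans[OF K[of 0 t]] mult_left_mono powr_mono2) auto
    finally show ?thesis by (simp add: M_def)
  qed
  define y where "y = (\<lambda>t. endo_apply (exp ((- (X t - X 0)) *\<^sub>R L)) (x t))"
  \<comment> \<open>The exponentials of multiples of \<open>L\<close> commute, so the flow can be undone up to time \<open>s\<close> and then on \<open>[s, t]\<close>.\<close>
  have exp_split: "exp ((- (X t - X 0)) *\<^sub>R L) = exp ((- (X s - X 0)) *\<^sub>R L) * exp ((- (X t - X s)) *\<^sub>R L)" for s t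
    using exp_scaleR_add[of "- (X s - X 0)" "- (X t - X s)" L] by simp
  have "norm (y t - y s) \<le> (E * (E * norm L ^ 3 * M * CX ^ 3) + E * K) * (t - s) powr (3 * \<alpha>)"
    if st: "0 \<le> s" "s \<le> t" "t \<le> T" for s t
  proof -
    define h where "h = X t - X s"
    define \<rho> where "\<rho> = x t - x s - ?F s t"
    define v where "v = x s + h *\<^sub>R endo_apply L (x s) + (h\<^sup>2 / 2) *\<^sub>R endo_apply L (endo_apply L (x s))"
    have xt: "x t = v + \<rho>" by (simp add: v_def \<rho>_def F[OF st] h_def)
    have "y t - y s = endo_apply (exp ((- (X s - X 0)) *\<^sub>R L)) (endo_apply (exp ((- h) *\<^sub>R L)) v - x s)
        + endo_apply (exp ((- (X t - X 0)) *\<^sub>R L)) \<rho>"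
      unfolding y_def xt endo.add_right exp_split[of t s] endo_apply_times h_def
      by (simp add: endo.diff_right)
    also have "norm \<dots> \<le> E * norm (endo_apply (exp ((- h) *\<^sub>R L)) v - x s) + E * norm \<rho>"
      by (intro order_trans[OF norm_triangle_ineq] add_mono order_trans[OF norm_endo_apply]
          mult_right_mono E norm_ge_zero) (use st in auto)
    also have "\<dots> \<le> E * (E * norm L ^ 3 * M * CX ^ 3 * (t - s) powr (3 * \<alpha>)) + E * (K * (t - s) powr (3 * \<alpha>))"
    proof (intro add_mono mult_left_mono)
      have "\<bar>h\<bar> ^ 3 \<le> (CX * (t - s) powr \<alpha>) ^ 3"
        using CX[OF st] by (intro power_mono) (auto simp: h_def)
      also have "\<dots> = CX ^ 3 * (t - s) powr (3 * \<alpha>)"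
        using st by (simp add: power_mult_distrib mult.commute flip: powr_powr powr_numeral)
      finally have h3: "\<bar>h\<bar> ^ 3 \<le> CX ^ 3 * (t - s) powr (3 * \<alpha>)" .
      have "norm (endo_apply (exp ((- h) *\<^sub>R L)) v - x s) \<le> exp (\<bar>h\<bar> * norm L) * norm L ^ 3 * norm (x s) * \<bar>h\<bar> ^ 3"
        unfolding v_def by (rule exp_taylor2_inverse_bound)
      also have "\<dots> \<le> E * norm L ^ 3 * M * (CX ^ 3 * (t - s) powr (3 * \<alpha>))"
        using H[OF st] M[of s] st order_trans[OF norm_ge_zero M[of s]]
        by (intro mult_mono h3) (auto simp: E_def h_def mult_right_mono)
      finally show "norm (endo_apply (exp ((- h) *\<^sub>R L)) v - x s) \<le> E * norm L ^ 3 * M * CX ^ 3 * (t - s) powr (3 * \<alpha>)"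
        by (simp add: mult_ac)
      show "norm \<rho> \<le> K * (t - s) powr (3 * \<alpha>)" unfolding \<rho>_def by (rule K[OF st])
    qed (auto simp: E_def)
    also have "\<dots> = (E * (E * norm L ^ 3 * M * CX ^ 3) + E * K) * (t - s) powr (3 * \<alpha>)"
      by (simp add: algebra_simps)
    finally show ?thesis .
  qed
  then have "y t = y 0"
    using \<open>1/3 < \<alpha>\<close> t by (intro constant_if_superlinear_increments[where p = "3 * \<alpha>" and b = T]) auto
  then have "endo_apply (exp ((- (X t - X 0)) *\<^sub>R L)) (x t) = x 0"
    by (simp add: y_def)
  then have "endo_apply (exp ((X t - X 0) *\<^sub>R L) * exp ((- (X t - X 0)) *\<^sub>R L)) (x t) =
      endo_apply (exp ((X t - X 0) *\<^sub>R L)) (x 0)"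
    by simp
  moreover have "exp ((X t - X 0) *\<^sub>R L) * exp ((- (X t - X 0)) *\<^sub>R L) = 1"
    by (simp flip: exp_scaleR_add)
  ultimately show ?thesis unfolding L_def by (metis endo_apply_one)
qed

section \<open>Flows of linear fields and diffeomorphism groups\<close>

lemma iterated_partial_linear_constant:
  assumes "linear f" "us \<noteq> []"
  shows "\<exists>c. iterated_partial us f = (\<lambda>_. c)"
  using \<open>us \<noteq> []\<close>
proof (induction us)
  case (Cons u us)
  have f: "(f has_derivative f) (at x)" for x
    using \<open>linear f\<close> by (intro bounded_linear_imp_has_derivative) (simp add: linear_conv_bounded_linear)
  show ?case
  proof (cases "us = []")
    case True
    then show ?thesis using frechet_derivative_at[OF f] by auto
  next
    case False
    then obtain c where "iterated_partial us f = (\<lambda>_. c)" using Cons.IH by blast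
    then show ?thesis by (auto simp: frechet_derivative_const)
  qed
qed simp

lemma smooth_linear:
  assumes "linear f" shows "smooth f"
  unfolding smooth_def
proof (intro allI impI)
  fix us :: "'a list" and x
  show "iterated_partial us f differentiable (at x)"
  proof (cases "us = []")
    case True
    then show ?thesis using \<open>linear f\<close>
      by (auto simp: linear_conv_bounded_linear intro: bounded_linear_imp_differentiable)
  next
    case False
    then show ?thesis using iterated_partial_linear_constant[OF \<open>linear f\<close>] by fastforce
  qed
qed

lemma flow_compositions_mono: "D \<subseteq> D' \<Longrightarrow> flow_compositions D \<subseteq> flow_compositions D'"
proof
  fix f assume "D \<subseteq> D'" "f \<in> flow_compositions D"
  show "f \<in> flow_compositions D'"
    using \<open>f \<in> flow_compositions D\<close>
  proof induction
    case (2 V \<Phi> f t)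
    with \<open>D \<subseteq> D'\<close> show ?case by (blast intro: flow_compositions.intros)
  qed (rule flow_compositions.intros)
qed

lemma flow_compositions_subset_Diff: "flow_compositions D \<subseteq> Diff D"
proof
  fix f assume f: "f \<in> flow_compositions D"
  then have "f \<in> flow_compositions UNIV" using flow_compositions_mono[of D UNIV] by auto
  with f show "f \<in> Diff D" by (auto simp: Diff_def intro!: bexI[of _ f])
qed

text \<open>
  A subspace is given here as the kernel of a linear map \<open>q\<close>: \<open>q\<close> is then constant along a field with
  values in the subspace.
\<close>
lemma flow_moves_in_kernel:
  fixes q :: "'a::euclidean_space \<Rightarrow> 'b::real_normed_vector"
  assumes q: "linear q" and V: "range V \<subseteq> {x. q x = 0}" and flow: "global_flow V \<Phi>"
  shows "q (\<Phi> t x - x) = 0"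
proof -
  have "((\<lambda>\<tau>. q (\<Phi> \<tau> x)) has_derivative (\<lambda>_. 0)) (at \<tau> within UNIV)" for \<tau>
  proof -
    have "((\<lambda>\<tau>. q (\<Phi> \<tau> x)) has_vector_derivative q (V (\<Phi> \<tau> x))) (at \<tau>)"
      using flow q by (auto simp: global_flow_def linear_conv_bounded_linear
          intro: bounded_linear.has_vector_derivative)
    moreover have "q (V (\<Phi> \<tau> x)) = 0" using V by blast
    ultimately show ?thesis by (simp add: has_vector_derivative_def)
  qed
  then obtain c where c: "\<And>\<tau>. q (\<Phi> \<tau> x) = c"
    using has_derivative_zero_constant[of UNIV "\<lambda>\<tau>. q (\<Phi> \<tau> x)"] by auto
  have "\<Phi> 0 x = x" using flow by (simp add: global_flow_def)
  then show ?thesis using c[of 0] c[of t] by (simp add: linear_diff[OF q])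
qed

text \<open>
  Displacements along compositions of such flows lie in the subspace, and pointwise limits (the case of
  a single point and of no derivative in the definition of the closure) stay there because it is closed.
\<close>
lemma Diff_moves_in_kernel:
  fixes q :: "'a::euclidean_space \<Rightarrow> 'b::real_normed_vector"
  assumes q: "linear q" and f: "f \<in> Diff {x. q x = 0}"
  shows "q (f x - x) = 0"
proof -
  let ?D = "{x. q x = 0}"
  have flows: "q (g x - x) = 0" if "g \<in> flow_compositions ?D" for g x
    using that
  proof (induction arbitrary: x)
    case (2 V \<Phi> f t)
    then show ?case
      using flow_moves_in_kernel[OF q, of V \<Phi> t "f x"] by (simp add: linear_diff[OF q])
  qed (simp add: linear_0[OF q])
  have "f x - x \<in> closure ?D"
    unfolding closure_approachable
  proof (intro allI impI)
    fix e :: real assume "0 < e"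
    have "\<forall>C N \<epsilon>. compact C \<and> \<epsilon> > 0 \<longrightarrow>
       (\<exists>g\<in>flow_compositions ?D. \<forall>us. set us \<subseteq> Basis \<and> length us \<le> N \<longrightarrow>
          (\<forall>x\<in>C. norm (iterated_partial us g x - iterated_partial us f x) < \<epsilon>))"
      using f unfolding Diff_def by blast
    from this[rule_format, of "{x}" e 0] \<open>0 < e\<close> obtain g where "g \<in> flow_compositions ?D"
      and g: "\<And>us y. set us \<subseteq> Basis \<Longrightarrow> length us \<le> 0 \<Longrightarrow> y \<in> {x} \<Longrightarrow>
        norm (iterated_partial us g y - iterated_partial us f y) < e"
      by auto
    then show "\<exists>y\<in>?D. dist y (f x - x) < e"
      using flows[of g x] g[of "[]" x] by (intro bexI[of _ "g x - x"]) (auto simp: dist_norm)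
  qed
  moreover have "closed ?D"
    using q by (intro closed_Collect_eq) (auto simp: linear_continuous_on linear_conv_bounded_linear)
  ultimately show ?thesis by simp
qed

section \<open>Cascade factorization along a flag of projections\<close>

text \<open>
  The projections \<open>P 0 = 0, \<dots>, P k = id\<close> have increasing ranges \<open>V\<^sub>i\<close> and decreasing kernels. Together they
  encode a direct sum decomposition, in which the block with number \<open>i\<close> (counted from 0) is the range
  of \<open>P (Suc i) - P i\<close>.
\<close>
locale projection_flag =
  fixes P :: "nat \<Rightarrow> 'a::euclidean_space \<Rightarrow> 'a" and k :: nat
  assumes linear_P: "linear (P i)"
    and P_P [simp]: "P i (P j x) = P (min i j) x"
    and P_0 [simp]: "P 0 x = 0"
    and P_k [simp]: "P k x = x"
begin

lemmas P_linear_simps [simp] =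
  linear_add[OF linear_P] linear_diff[OF linear_P] linear_0[OF linear_P] linear_scale[OF linear_P]

definition block_proj :: "nat \<Rightarrow> 'a \<Rightarrow> 'a" where
  "block_proj i x = P (Suc i) x - P i x"

lemma linear_block_proj: "linear (block_proj i)"
  unfolding block_proj_def by (intro linear_compose_sub linear_P)

lemma block_proj_idem [simp]: "block_proj i (block_proj i x) = block_proj i x"
  by (simp add: block_proj_def)

lemma P_block_proj:
  "P j (block_proj i x) = (if j \<le> i then 0 else block_proj i x)"
  by (auto simp: block_proj_def min_def not_less_eq_eq)

lemma range_block_proj: "range (block_proj i) = {x. x - block_proj i x = 0}"
  by (auto simp: image_iff)

definition flag_preserving :: "('a \<Rightarrow> 'a) \<Rightarrow> bool" where
  "flag_preserving f \<longleftrightarrow> (\<forall>i x. P i (f (P i x)) = f (P i x))"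

text \<open>
  A map that preserves the flag is block triangular. On \<open>V\<^sub>i\<^sub>+\<^sub>1\<close> its component in the \<open>i\<close>-th block therefore
  depends only on the \<open>i\<close>-th block of the argument. This makes passing to a diagonal block multiplicative.
\<close>
lemma block_proj_absorb:
  assumes "linear f" "flag_preserving f" "P (Suc i) w = w"
  shows "block_proj i (f (block_proj i w)) = block_proj i (f w)"
proof -
  have "P i (f (P i w)) = f (P i w)" "P (Suc i) (f (P i w)) = f (P i w)"
    using \<open>flag_preserving f\<close> unfolding flag_preserving_def
    by (metis P_P min.absorb2 le_SucI order_refl)+
  then have "block_proj i (f (P i w)) = 0" by (simp add: block_proj_def)
  moreover have "block_proj i w = w - P i w" using assms(3) by (simp add: block_proj_def)
  ultimately show ?thesis
    by (simp add: linear_diff[OF \<open>linear f\<close>] linear_diff[OF linear_block_proj])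
qed

definition flag_iso :: "('a \<Rightarrow> 'a) \<Rightarrow> bool" where
  "flag_iso f \<longleftrightarrow> linear f \<and> flag_preserving f \<and> (\<exists>g. flag_preserving g \<and> (\<forall>x. g (f x) = x))"

text \<open>
  The map \<open>f\<close> in the blocks from number \<open>i\<close> on, and the identity in the blocks before. In a cascade it is
  the composition of the factors with numbers \<open>i, \<dots>, k - 1\<close>.
\<close>
definition tail_map :: "('a \<Rightarrow> 'a) \<Rightarrow> nat \<Rightarrow> 'a \<Rightarrow> 'a" where
  "tail_map f i x = P i x + (f x - P i (f x))"

lemma tail_map_0 [simp]: "tail_map f 0 = f" and tail_map_k [simp]: "tail_map f k = id"
  by (auto simp: tail_map_def)

lemma linear_tail_map: "linear f \<Longrightarrow> linear (tail_map f i)"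
  unfolding tail_map_def using linear_compose[of f "P i"]
  by (intro linear_compose_add linear_compose_sub linear_P) (auto simp: o_def linear_P)

text \<open>
  This is the absence of explosion. If \<open>tail_map f i x = 0\<close> then \<open>P i x = 0\<close> and \<open>f x\<close> lies in the range of
  \<open>P i\<close>. The inverse \<open>g\<close> of \<open>f\<close> preserves this range, so \<open>x = g (f x)\<close> lies in it as well, and \<open>x = P i x = 0\<close>.
\<close>
lemma bij_tail_map:
  assumes "flag_iso f" shows "bij (tail_map f i)"
proof -
  from assms obtain g where "linear f" and g: "\<And>i x. P i (g (P i x)) = g (P i x)" "\<And>x. g (f x) = x"
    by (auto simp: flag_iso_def flag_preserving_def)
  have lin: "linear (tail_map f i)" by (rule linear_tail_map) fact
  have "x = 0" if "tail_map f i x = 0" for x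
  proof -
    have "P i (tail_map f i x) = 0" using that by simp
    then have "P i x = 0" by (simp add: tail_map_def)
    with that have "f x = P i (f x)" by (simp add: tail_map_def)
    then have "x = P i x" using g(1)[of i "f x"] g(2)[of x] by simp
    with \<open>P i x = 0\<close> show ?thesis by simp
  qed
  then have "inj (tail_map f i)" using linear_injective_0[OF lin] by blast
  with lin show ?thesis by (simp add: bij_def linear_inj_imp_surj)
qed

definition cascade_factor :: "('a \<Rightarrow> 'a) \<Rightarrow> nat \<Rightarrow> 'a \<Rightarrow> 'a" where
  "cascade_factor f i = tail_map f i \<circ> inv_into UNIV (tail_map f (Suc i))"

lemma cascade_factor_tail_map: "flag_iso f \<Longrightarrow> cascade_factor f i (tail_map f (Suc i) y) = tail_map f i y"
  using bij_tail_map[of f "Suc i"] by (simp add: cascade_factor_def bij_is_inj)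

lemma linear_cascade_factor:
  assumes "flag_iso f" shows "linear (cascade_factor f i)"
proof -
  have "linear f" using assms by (simp add: flag_iso_def)
  then show ?thesis
    unfolding cascade_factor_def using bij_tail_map[OF assms, of "Suc i"]
    by (intro linear_compose linear_tail_map inj_linear_imp_inv_linear) (auto simp: bij_is_inj linear_tail_map)
qed

lemma cascade_factor_minus_id_in_block:
  assumes "flag_iso f" shows "cascade_factor f i x - x \<in> range (block_proj i)"
proof -
  obtain y where "x = tail_map f (Suc i) y"
    using bij_tail_map[OF assms] by (metis bij_pointE)
  then have "cascade_factor f i x - x = block_proj i (f y - y)"
    by (simp add: cascade_factor_tail_map[OF assms]) (simp add: tail_map_def block_proj_def)
  then show ?thesis by simp
qed

text \<open>The composition telescopes.\<close>
lemma compose_cascade_factors_from: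
  assumes "flag_iso f" "i \<le> k"
  shows "foldr (\<circ>) (map (cascade_factor f) [i..<k]) id = tail_map f i"
  using \<open>i \<le> k\<close>
proof (induction rule: inc_induct)
  case (step i)
  then have "[i..<k] = i # [Suc i..<k]" by (simp add: upt_conv_Cons)
  then show ?case using step.IH by (simp add: fun_eq_iff cascade_factor_tail_map[OF assms(1)])
qed simp

lemma compose_cascade_factors: "flag_iso f \<Longrightarrow> foldr (\<circ>) (map (cascade_factor f) [0..<k]) id = f"
  using compose_cascade_factors_from[of f 0] by simp

lemma cascade_factor_id [simp]: "cascade_factor id i = id"
proof -
  have "tail_map id i = id" for i by (auto simp: tail_map_def)
  then show ?thesis by (simp add: cascade_factor_def)
qed

text \<open>
  The composition \<open>\<eta> i\<close> of the factors with numbers \<open>\<ge> i\<close> does not change the blocks before \<open>i\<close>. The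
  remaining factors change only those blocks, so in the others \<open>\<eta> i\<close> agrees with \<open>f\<close>. Thus
  \<open>\<eta> i = tail_map f i\<close>, and \<open>h i \<circ> \<eta> (Suc i) = \<eta> i\<close> determines \<open>h i\<close>.
\<close>
lemma cascade_factor_unique:
  assumes iso: "flag_iso f" and f: "f = foldr (\<circ>) (map h [0..<k]) id"
    and h: "\<And>i x. i < k \<Longrightarrow> h i x - x \<in> range (block_proj i)"
    and "i < k"
  shows "h i = cascade_factor f i"
proof -
  define \<eta> where "\<eta> i = foldr (\<circ>) (map h [i..<k]) id" for i
  have \<eta>_k: "\<eta> k = id" by (simp add: \<eta>_def)
  have \<eta>_Suc: "\<eta> i = h i \<circ> \<eta> (Suc i)" if "i < k" for i
    using that by (simp add: \<eta>_def upt_conv_Cons)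
  have P_h: "P j (h i x) = P j x" if "j \<le> i" "i < k" for i j x
  proof -
    obtain w where "h i x = x + block_proj i w"
      using h[OF \<open>i < k\<close>, of x] by (metis add.commute diff_add_cancel imageE)
    then show ?thesis using that by (simp add: P_block_proj)
  qed
  have Q_h: "h i x - P j (h i x) = x - P j x" if "i < j" "i < k" for i j x
  proof -
    obtain w where "h i x = x + block_proj i w"
      using h[OF \<open>i < k\<close>, of x] by (metis add.commute diff_add_cancel imageE)
    then show ?thesis using that by (simp add: P_block_proj)
  qed
  have P_\<eta>: "\<forall>j\<le>i. P j (\<eta> i x) = P j x" if "i \<le> k" for i x
    using that by (induction rule: inc_induct) (auto simp: \<eta>_k \<eta>_Suc P_h)
  have Q_\<eta>: "\<forall>j\<ge>i. f x - P j (f x) = \<eta> i x - P j (\<eta> i x)" if "i \<le> k" for i x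
    using that
  proof (induction i)
    case 0
    show ?case by (simp add: \<eta>_def f)
  next
    case (Suc i)
    then show ?case using \<eta>_Suc[of i] Q_h[of i] by auto
  qed
  have \<eta>: "\<eta> i = tail_map f i" if "i \<le> k" for i
    using P_\<eta>[OF that] Q_\<eta>[OF that] by (auto simp: tail_map_def fun_eq_iff)
  have "h i (tail_map f (Suc i) y) = tail_map f i y" for y
    using \<eta>_Suc[OF \<open>i < k\<close>] \<eta>[of i] \<eta>[of "Suc i"] \<open>i < k\<close> by (metis comp_apply less_or_eq_imp_le Suc_leI)
  then have "h i (tail_map f (Suc i) y) = cascade_factor f i (tail_map f (Suc i) y)" for y
    by (simp add: cascade_factor_tail_map[OF iso])
  then show ?thesis
    using bij_tail_map[OF iso, of "Suc i"] by (metis ext bij_pointE)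
qed

end

section \<open>Factors of a one-parameter group\<close>

locale flag_invariant_operator = projection_flag +
  fixes L :: "'a endo"
  assumes invariant: "flag_preserving (endo_apply L)"
begin

abbreviation flow :: "real \<Rightarrow> 'a \<Rightarrow> 'a" where
  "flow s \<equiv> endo_apply (exp (s *\<^sub>R L))"

lemma flow_0 [simp]: "flow 0 = id"
  by (simp add: fun_eq_iff)

lemma flow_add: "flow (s + t) x = flow s (flow t x)"
  by (simp add: exp_scaleR_add)

lemma flow_preserving: "flag_preserving (flow s)"
  unfolding flag_preserving_def
proof (intro allI)
  fix i x
  define p where "p = endo_of (P i)"
  have p: "endo_apply p = P i" by (simp add: p_def linear_P)
  have "p * p = p" by (rule endo_eqI) (simp add: p)
  moreover have "(s *\<^sub>R L) * p = p * (s *\<^sub>R L) * p"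
    using invariant by (intro endo_eqI) (simp add: p endo.scaleR_left flag_preserving_def)
  ultimately have "exp (s *\<^sub>R L) * p = p * exp (s *\<^sub>R L) * p" by (rule exp_invariant)
  then show "P i (flow s (P i x)) = flow s (P i x)" by (metis endo_apply_times p)
qed

lemma P_flow_P: "P i (flow s (P i x)) = flow s (P i x)"
  using flow_preserving by (simp add: flag_preserving_def)

lemma flow_iso: "flag_iso (flow s)"
  unfolding flag_iso_def
proof (intro conjI exI allI)
  show "flow (- s) (flow s x) = x" for x
    using flow_add[of "- s" s x] by simp
qed (simp_all only: linear_endo_apply flow_preserving)

text \<open>
  The diagonal block of \<open>exp (t L)\<close> with number \<open>i\<close>, extended by the identity to the other blocks. It is the
  flow of the field given by the diagonal block of \<open>L\<close>.
\<close>
definition block_flow :: "nat \<Rightarrow> real \<Rightarrow> 'a \<Rightarrow> 'a" where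
  "block_flow i t x = x - block_proj i x + block_proj i (flow t (block_proj i x))"

lemma P_Suc_flow_block_proj:
  "P (Suc i) (flow t (block_proj i x)) = flow t (block_proj i x)"
proof -
  have "P (Suc i) (block_proj i x) = block_proj i x" by (simp add: P_block_proj)
  then show ?thesis by (metis P_flow_P)
qed

lemma block_proj_block_flow:
  "block_proj i (block_flow i t x) = block_proj i (flow t (block_proj i x))"
  by (simp add: block_flow_def linear_add[OF linear_block_proj] linear_diff[OF linear_block_proj])

lemma linear_block_flow: "linear (block_flow i t)"
proof -
  have "block_flow i t = (\<lambda>x. (x - block_proj i x) + (block_proj i \<circ> flow t \<circ> block_proj i) x)"
    by (simp add: fun_eq_iff block_flow_def)
  then show ?thesis
    by (simp only:) (intro linear_compose_add linear_compose_sub linear_compose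
        linear_block_proj linear_endo_apply linear_id[unfolded id_def])
qed

lemma block_flow_minus_id: "block_flow i t x - x = block_proj i (flow t (block_proj i x) - x)"
  by (simp add: block_flow_def linear_diff[OF linear_block_proj])

lemma block_flow_add: "block_flow i (s + t) = block_flow i s \<circ> block_flow i t"
proof
  fix x
  have "block_proj i (flow s (block_proj i (flow t (block_proj i x)))) =
      block_proj i (flow (s + t) (block_proj i x))"
    using block_proj_absorb[OF linear_endo_apply flow_preserving P_Suc_flow_block_proj]
    by (simp only: flow_add)
  then show "block_flow i (s + t) x = (block_flow i s \<circ> block_flow i t) x"
    by (simp add: block_flow_def[of i s] block_proj_block_flow) (simp add: block_flow_def)
qed

lemma block_flow_0 [simp]: "block_flow i 0 = id"
  by (simp add: fun_eq_iff block_flow_def)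

lemma block_flow_has_vector_derivative:
  "((\<lambda>\<tau>. block_flow i \<tau> x) has_vector_derivative
     block_proj i (endo_apply L (block_proj i (block_flow i t x)))) (at t)"
proof -
  have "((\<lambda>\<tau>. block_flow i \<tau> x) has_vector_derivative
      0 + block_proj i (endo_apply L (flow t (block_proj i x)))) (at t)"
    unfolding block_flow_def using linear_block_proj[of i]
    by (intro has_vector_derivative_add has_vector_derivative_const
        bounded_linear.has_vector_derivative[of "block_proj i"] exp_apply_has_vector_derivative)
       (simp add: linear_conv_bounded_linear)
  moreover have "block_proj i (endo_apply L (flow t (block_proj i x))) =
      block_proj i (endo_apply L (block_proj i (block_flow i t x)))"
    unfolding block_proj_block_flow
    using block_proj_absorb[OF linear_endo_apply invariant P_Suc_flow_block_proj] by simp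
  ultimately show ?thesis by simp
qed

lemma global_flow_block_flow:
  "global_flow (\<lambda>x. block_proj i (endo_apply (s *\<^sub>R L) (block_proj i x))) (\<lambda>\<tau>. block_flow i (\<tau> * s))"
  unfolding global_flow_def
proof (intro conjI allI)
  show "block_flow i (0 * s) = id" by simp
  show "block_flow i ((t + u) * s) = block_flow i (t * s) \<circ> block_flow i (u * s)" for t u
    by (simp add: distrib_right block_flow_add)
  fix t x
  have "((\<lambda>\<tau>. \<tau> * s) has_vector_derivative s) (at t)"
    by (auto intro!: derivative_eq_intros)
  from vector_diff_chain_at[OF this block_flow_has_vector_derivative]
  show "((\<lambda>\<tau>. block_flow i (\<tau> * s) x) has_vector_derivative
      block_proj i (endo_apply (s *\<^sub>R L) (block_proj i (block_flow i (t * s) x)))) (at t)"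
    by (simp add: o_def endo.scaleR_left linear_scale[OF linear_block_proj])
qed

text \<open>
  The factor and \<open>block_flow i s\<close> both change the \<open>i\<close>-th block only, and they agree on vectors of this
  block. Hence \<open>block_flow i (- s) \<circ> cascade_factor (flow s) i = id + S\<close>, where \<open>S\<close> has values in the
  block and vanishes on it. So \<open>S \<circ> S = 0\<close>, and \<open>id + S\<close> is the time-one map of the flow \<open>id + \<tau> S\<close> of the
  linear field \<open>S\<close>.
\<close>
lemma cascade_factor_flow_in_flow_compositions:
  "cascade_factor (flow s) i \<in> flow_compositions (range (block_proj i))"
proof -
  let ?D = "range (block_proj i)"
  let ?\<xi> = "cascade_factor (flow s) i"
  define S where "S = (\<lambda>x. block_flow i (- s) (?\<xi> x) - x)"
  have lin: "linear S"
    unfolding S_def using linear_compose[OF linear_cascade_factor[OF flow_iso] linear_block_flow]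
    by (intro linear_compose_sub) (auto simp: o_def intro: linear_id[unfolded id_def])
  have S_in: "S x \<in> ?D" for x
  proof -
    obtain y z where "block_flow i (- s) (?\<xi> x) - ?\<xi> x = block_proj i y" "?\<xi> x - x = block_proj i z"
      using block_flow_minus_id cascade_factor_minus_id_in_block[OF flow_iso] by blast
    then have "S x = block_proj i (y + z)"
      by (simp add: S_def linear_add[OF linear_block_proj] algebra_simps)
    then show ?thesis by simp
  qed
  have S_block: "S (block_proj i x) = 0" for x
  proof -
    let ?x = "block_proj i x"
    have "P (Suc i) (flow s ?x) = flow s ?x" by (rule P_Suc_flow_block_proj)
    then have "tail_map (flow s) (Suc i) ?x = ?x" and
      "tail_map (flow s) i ?x = block_proj i (flow s ?x)"
      by (simp_all add: tail_map_def P_block_proj) (simp add: block_proj_def)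
    then have "?\<xi> ?x = block_proj i (flow s ?x)"
      using cascade_factor_tail_map[OF flow_iso, of s i ?x] by simp
    then have "?\<xi> ?x = block_flow i s ?x" by (simp add: block_flow_def)
    then show ?thesis using block_flow_add[of i "- s" s] by (simp add: S_def fun_eq_iff)
  qed
  have S_S: "S (S x) = 0" for x
    using S_in[of x] S_block by auto
  define \<Psi> where "\<Psi> = (\<lambda>\<tau> x. x + \<tau> *\<^sub>R S x)"
  have "global_flow S \<Psi>"
    unfolding global_flow_def
  proof (intro conjI allI)
    show "\<Psi> 0 = id" by (simp add: \<Psi>_def fun_eq_iff)
    show "\<Psi> (t + u) = \<Psi> t \<circ> \<Psi> u" for t u
      by (simp add: \<Psi>_def fun_eq_iff linear_add[OF lin] linear_scale[OF lin] S_S algebra_simps)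
    show "((\<lambda>\<tau>. \<Psi> \<tau> x) has_vector_derivative S (\<Psi> t x)) (at t)" for t x
      unfolding \<Psi>_def
      by (auto intro!: derivative_eq_intros simp: linear_add[OF lin] linear_scale[OF lin] S_S)
  qed
  moreover have "smooth S" by (rule smooth_linear) fact
  moreover have "range S \<subseteq> ?D" using S_in by blast
  ultimately have "\<Psi> 1 \<circ> id \<in> flow_compositions ?D"
    by (intro flow_compositions.intros)
  moreover have "smooth (\<lambda>x. block_proj i (endo_apply (s *\<^sub>R L) (block_proj i x)))"
    using linear_compose[OF linear_compose[OF linear_block_proj linear_endo_apply] linear_block_proj]
    by (intro smooth_linear) (simp add: o_def)
  ultimately have "block_flow i (1 * s) \<circ> (\<Psi> 1 \<circ> id) \<in> flow_compositions ?D"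
    by (intro flow_compositions.intros(2)[OF _ _ global_flow_block_flow]) auto
  moreover have "block_flow i (1 * s) \<circ> (\<Psi> 1 \<circ> id) = ?\<xi>"
    using block_flow_add[of i s "- s"] by (simp add: fun_eq_iff \<Psi>_def S_def)
  ultimately show ?thesis by simp
qed

lemma cascade_factor_flow_in_Diff: "cascade_factor (flow s) i \<in> Diff (range (block_proj i))"
  using cascade_factor_flow_in_flow_compositions flow_compositions_subset_Diff by blast

end

section \<open>Coordinates in an ordered basis and real Jordan matrices\<close>

definition basis_coord :: "(nat \<Rightarrow> real^'n) \<Rightarrow> nat \<Rightarrow> real^'n \<Rightarrow> real" where
  "basis_coord b r x = representation (b ` {..<CARD('n)}) x (b r)"

definition basis_truncate :: "(nat \<Rightarrow> real^'n) \<Rightarrow> nat \<Rightarrow> real^'n \<Rightarrow> real^'n" where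
  "basis_truncate b m x = (\<Sum>r | r < m \<and> r < CARD('n). basis_coord b r x *\<^sub>R b r)"

context
  fixes b :: "nat \<Rightarrow> real^'n"
  assumes basis: "ordered_basis b"
begin

lemma linear_basis_coord: "linear (basis_coord b r)"
  using basis unfolding ordered_basis_def basis_coord_def
  by (intro linearI) (simp_all add: representation_add representation_scale)

lemma basis_coord_basis:
  "r < CARD('n) \<Longrightarrow> c < CARD('n) \<Longrightarrow> basis_coord b r (b c) = (if r = c then 1 else 0)"
  using basis unfolding ordered_basis_def basis_coord_def
  by (auto simp: representation_basis inj_on_eq_iff)

lemma basis_expansion: "(\<Sum>r<CARD('n). basis_coord b r x *\<^sub>R b r) = x"
proof -
  have "(\<Sum>v\<in>b ` {..<CARD('n)}. representation (b ` {..<CARD('n)}) x v *\<^sub>R v) = x"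
    using basis unfolding ordered_basis_def by (intro sum_representation_eq) auto
  then show ?thesis
    using basis unfolding ordered_basis_def basis_coord_def by (simp add: sum.reindex)
qed

lemma basis_coord_eqI: "(\<And>r. r < CARD('n) \<Longrightarrow> basis_coord b r x = basis_coord b r y) \<Longrightarrow> x = y"
  using basis_expansion[of x] basis_expansion[of y] by (metis (no_types, lifting) lessThan_iff sum.cong)

lemma linear_basis_truncate: "linear (basis_truncate b m)"
  unfolding basis_truncate_def
  by (intro linear_compose_sum ballI linear_compose_scale_right linearI)
     (simp_all add: linear_add[OF linear_basis_coord] linear_scale[OF linear_basis_coord] algebra_simps)

lemma basis_coord_sum:
  assumes "r < CARD('n)" "I \<subseteq> {..<CARD('n)}"
  shows "basis_coord b r (\<Sum>j\<in>I. f j *\<^sub>R b j) = (if r \<in> I then f r else 0)"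
proof -
  have "finite I" using assms(2) finite_subset by blast
  have "basis_coord b r (\<Sum>j\<in>I. f j *\<^sub>R b j) = (\<Sum>j\<in>I. f j * basis_coord b r (b j))"
    by (simp add: linear_sum[OF linear_basis_coord] linear_scale[OF linear_basis_coord])
  also have "\<dots> = (\<Sum>j\<in>I. if j = r then f r else 0)"
    using assms by (intro sum.cong) (auto simp: basis_coord_basis)
  finally show ?thesis using \<open>finite I\<close> by simp
qed

lemma basis_coord_truncate:
  "r < CARD('n) \<Longrightarrow> basis_coord b r (basis_truncate b m x) = (if r < m then basis_coord b r x else 0)"
  unfolding basis_truncate_def by (subst basis_coord_sum) auto

lemma matrix_in_basis_index:
  "r < CARD('n) \<Longrightarrow> c < CARD('n) \<Longrightarrow> matrix_in_basis b f $$ (r, c) = basis_coord b r (f (b c))"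
  by (simp add: matrix_in_basis_def basis_coord_def)

lemma matrix_in_basis_compose:
  assumes "linear f"
  shows "matrix_in_basis b (f \<circ> g) = matrix_in_basis b f * matrix_in_basis b g"
proof (rule eq_matI)
  fix r c assume "r < dim_row (matrix_in_basis b f * matrix_in_basis b g)"
    and "c < dim_col (matrix_in_basis b f * matrix_in_basis b g)"
  then have rc: "r < CARD('n)" "c < CARD('n)" by (simp_all add: matrix_in_basis_def)
  have "basis_coord b r (f (g (b c))) = basis_coord b r (f (\<Sum>j<CARD('n). basis_coord b j (g (b c)) *\<^sub>R b j))"
    by (simp add: basis_expansion)
  also have "\<dots> = (\<Sum>j<CARD('n). basis_coord b j (g (b c)) * basis_coord b r (f (b j)))"
    by (simp add: linear_sum[OF assms] linear_scale[OF assms] linear_sum[OF linear_basis_coord]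
        linear_scale[OF linear_basis_coord])
  also have "\<dots> = (matrix_in_basis b f * matrix_in_basis b g) $$ (r, c)"
    using rc by (simp add: matrix_in_basis_def basis_coord_def scalar_prod_def mult.commute lessThan_atLeast0)
  finally show "matrix_in_basis b (f \<circ> g) $$ (r, c) = (matrix_in_basis b f * matrix_in_basis b g) $$ (r, c)"
    using rc by (simp add: matrix_in_basis_index)
qed (simp_all add: matrix_in_basis_def)

lemma matrix_in_basis_id: "matrix_in_basis b id = 1\<^sub>m CARD('n)"
  by (rule eq_matI) (auto simp: matrix_in_basis_index basis_coord_basis, auto simp: matrix_in_basis_def)

lemma matrix_in_basis_foldr:
  "(\<And>f. f \<in> set fs \<Longrightarrow> linear f) \<Longrightarrow>
    matrix_in_basis b (foldr (\<circ>) fs id) = foldr (*) (map (matrix_in_basis b) fs) (1\<^sub>m CARD('n))"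
  by (induction fs) (simp_all add: matrix_in_basis_id matrix_in_basis_compose)

end

definition block_start :: "nat list \<Rightarrow> nat \<Rightarrow> nat" where
  "block_start ds i = sum_list (take i ds)"

lemma block_start_mono: "i \<le> j \<Longrightarrow> block_start ds i \<le> block_start ds j"
proof -
  assume "i \<le> j"
  then have "take j ds = take i ds @ take (j - i) (drop i ds)"
    by (metis le_add_diff_inverse take_add)
  then show ?thesis by (simp add: block_start_def)
qed

lemma real_jordan_block_dim:
  "dim_row (real_jordan_block m \<mu>) = m * (if \<mu> \<in> \<real> then 1 else 2)"
  "dim_col (real_jordan_block m \<mu>) = m * (if \<mu> \<in> \<real> then 1 else 2)"
  by (auto simp: real_jordan_block_def)

lemma real_jordan_block_upper_triangular:
  assumes "c < i * (if \<mu> \<in> \<real> then 1 else 2)" "i * (if \<mu> \<in> \<real> then 1 else 2) \<le> r"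
    "r < m * (if \<mu> \<in> \<real> then 1 else 2)"
  shows "real_jordan_block m \<mu> $$ (r, c) = 0"
proof (cases "\<mu> \<in> \<real>")
  case True
  then show ?thesis using assms by (simp add: real_jordan_block_def)
next
  case False
  then have "c div 2 < i" "i \<le> r div 2" using assms by auto
  then show ?thesis using False assms by (auto simp: real_jordan_block_def)
qed

lemma real_jordan_matrix_dim:
  "dim_row (real_jordan_matrix js) = sum_list (block_sizes js)"
  "dim_col (real_jordan_matrix js) = sum_list (block_sizes js)"
  by (induction js)
     (auto simp: real_jordan_matrix_def block_sizes_def Let_def real_jordan_block_dim sum_list_replicate)

text \<open>
  Entries below the diagonal blocks vanish. Only a bound that is the start of a diagonal block may
  separate column and row: inside a \<open>2 \<times> 2\<close> block the entry below the diagonal is \<open>- Im \<mu>\<close>.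
\<close>
lemma real_jordan_matrix_upper_triangular:
  assumes "c < block_start (block_sizes js) i" "block_start (block_sizes js) i \<le> r"
    "r < dim_row (real_jordan_matrix js)"
  shows "real_jordan_matrix js $$ (r, c) = 0"
  using assms
proof (induction js arbitrary: i r c)
  case Nil
  then show ?case by (simp add: real_jordan_matrix_def)
next
  case (Cons j js)
  obtain m \<mu> where j: "j = (m, \<mu>)" by (cases j)
  define d :: nat where "d = (if \<mu> \<in> \<real> then 1 else 2)"
  let ?B = "real_jordan_block m \<mu>" and ?J = "real_jordan_matrix js"
  have dims: "dim_row ?B = m * d" "dim_col ?B = m * d" by (simp_all add: real_jordan_block_dim d_def)
  have J: "real_jordan_matrix (j # js) =
      four_block_mat ?B (0\<^sub>m (m * d) (dim_col ?J)) (0\<^sub>m (dim_row ?J) (m * d)) ?J"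
    by (simp add: real_jordan_matrix_def j Let_def dims)
  have start: "block_start (block_sizes (j # js)) i =
      (if i \<le> m then i * d else m * d + block_start (block_sizes js) (i - m))"
    by (auto simp: block_start_def block_sizes_def j d_def sum_list_replicate min_def)
  have r: "r < m * d + dim_row ?J" using Cons.prems(3) by (simp add: J dims)
  have "c < m * d + dim_col ?J"
    using Cons.prems r by (simp add: real_jordan_matrix_dim)
  then have entry: "real_jordan_matrix (j # js) $$ (r, c) =
      (if r < m * d then if c < m * d then ?B $$ (r, c) else 0
       else if c < m * d then 0 else ?J $$ (r - m * d, c - m * d))"
    using r unfolding J by (subst index_mat_four_block) (auto simp: dims)
  show ?case
  proof (cases "i \<le> m")
    case True
    then have "c < i * d" "i * d \<le> r" "i * d \<le> m * d"
      using Cons.prems by (simp_all add: start)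
    moreover from this have "c < m * d" by (simp only: less_le_trans)
    ultimately show ?thesis
      unfolding entry using real_jordan_block_upper_triangular[of c i \<mu> r m]
      by (auto simp: d_def[symmetric])
  next
    case False
    with Cons.prems r show ?thesis
      unfolding entry start using Cons.IH[of "c - m * d" "i - m" "r - m * d"]
      by auto
  qed
qed

context
  fixes b :: "nat \<Rightarrow> real^'n" and ds :: "nat list"
  assumes basis: "ordered_basis b" and sizes: "sum_list ds = CARD('n)"
begin

lemma projection_flag_basis:
  "projection_flag (\<lambda>i. basis_truncate b (block_start ds i)) (length ds)"
proof (rule projection_flag.intro)
  show "linear (basis_truncate b (block_start ds i))" for i
    by (rule linear_basis_truncate[OF basis])
  show "basis_truncate b (block_start ds i) (basis_truncate b (block_start ds j) x) =
      basis_truncate b (block_start ds (min i j)) x" for i j x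
    using block_start_mono[of i j ds] block_start_mono[of j i ds]
    by (intro basis_coord_eqI[OF basis]) (auto simp: basis_coord_truncate[OF basis] min_def)
  show "basis_truncate b (block_start ds 0) x = 0" for x
    by (simp add: basis_truncate_def block_start_def)
  show "basis_truncate b (block_start ds (length ds)) x = x" for x
    by (rule basis_coord_eqI[OF basis]) (simp add: basis_coord_truncate[OF basis] block_start_def sizes)
qed

interpretation projection_flag "\<lambda>i. basis_truncate b (block_start ds i)" "length ds"
  by (rule projection_flag_basis)

lemma block_rows_eq: "block_rows ds i = {block_start ds i..<block_start ds (Suc i)}"
  by (simp add: block_rows_def block_start_def)

lemma block_rows_subset: "i < length ds \<Longrightarrow> block_rows ds i \<subseteq> {..<CARD('n)}"
  using block_start_mono[of "Suc i" "length ds" ds] by (auto simp: block_rows_eq block_start_def sizes)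

lemma basis_coord_block_proj:
  "r < CARD('n) \<Longrightarrow> basis_coord b r (block_proj i x) = (if r \<in> block_rows ds i then basis_coord b r x else 0)"
  using block_start_mono[of i "Suc i" ds]
  by (auto simp: block_proj_def linear_diff[OF linear_basis_coord[OF basis]]
      basis_coord_truncate[OF basis] block_rows_eq)

lemma range_block_proj_eq_span:
  assumes "i < length ds"
  shows "range (block_proj i) = span (b ` block_rows ds i)"
proof
  show "range (block_proj i) \<subseteq> span (b ` block_rows ds i)"
  proof
    fix y assume "y \<in> range (block_proj i)"
    then obtain x where y: "y = block_proj i x" by blast
    have "basis_coord b r y *\<^sub>R b r \<in> span (b ` block_rows ds i)" if "r < CARD('n)" for r
      using that by (auto simp: y basis_coord_block_proj intro: span_scale span_base span_zero)
    then have "(\<Sum>r<CARD('n). basis_coord b r y *\<^sub>R b r) \<in> span (b ` block_rows ds i)"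
      by (intro span_sum) auto
    then show "y \<in> span (b ` block_rows ds i)" by (simp add: basis_expansion[OF basis])
  qed
  have "block_proj i (b r) = b r" if "r \<in> block_rows ds i" for r
    using that block_rows_subset[OF assms]
    by (intro basis_coord_eqI[OF basis]) (auto simp: basis_coord_block_proj basis_coord_basis[OF basis])
  then have "b ` block_rows ds i \<subseteq> range (block_proj i)"
    by (metis image_subsetI rangeI)
  then show "span (b ` block_rows ds i) \<subseteq> range (block_proj i)"
    by (intro span_minimal linear_subspace_image[OF linear_block_proj] subspace_UNIV)
qed

text \<open>Only the images of the first basis vectors, those before the \<open>i\<close>-th block, enter \<open>f (P i x)\<close>.\<close>
lemma block_triangular_flag_preserving:
  assumes "linear f"
    and tri: "\<And>i r c. c < block_start ds i \<Longrightarrow> block_start ds i \<le> r \<Longrightarrow> r < CARD('n) \<Longrightarrow>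
      matrix_in_basis b f $$ (r, c) = 0"
  shows "flag_preserving f"
  unfolding flag_preserving_def
proof (intro allI basis_coord_eqI[OF basis])
  fix i x r assume r: "r < CARD('n)"
  let ?m = "block_start ds i"
  have "basis_coord b r (f (basis_truncate b ?m x)) = 0" if "?m \<le> r"
  proof -
    have "basis_coord b r (f (basis_truncate b ?m x)) =
        (\<Sum>c | c < ?m \<and> c < CARD('n). basis_coord b c x * basis_coord b r (f (b c)))"
      unfolding basis_truncate_def
      by (simp add: linear_sum[OF assms(1)] linear_scale[OF assms(1)]
          linear_sum[OF linear_basis_coord[OF basis]] linear_scale[OF linear_basis_coord[OF basis]])
    also have "\<dots> = 0"
      using tri[of _ i r] that r by (intro sum.neutral) (auto simp: matrix_in_basis_index[OF basis])
    finally show ?thesis .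
  qed
  then show "basis_coord b r (basis_truncate b ?m (f (basis_truncate b ?m x))) =
      basis_coord b r (f (basis_truncate b ?m x))"
    using r by (simp add: basis_coord_truncate[OF basis])
qed

end

section \<open>Cascade decomposition of the rough flow\<close>

theorem proposition4p5:
  fixes A :: "real^'n^'n"
    and \<alpha> T :: real
    and X :: "real \<Rightarrow> real" and XX :: "real \<Rightarrow> real \<Rightarrow> real"
    and \<phi> :: "real \<Rightarrow> real^'n \<Rightarrow> real^'n"
    and js :: "(nat \<times> complex) list"
    and b :: "nat \<Rightarrow> real^'n"
    and ds :: "nat list"
    and \<Delta> :: "(real^'n) set list"
  assumes "0 < T" and "1/3 < \<alpha>" and "\<alpha> \<le> 1/2"
    and "geometric_rough_path \<alpha> T X XX"
    and "linear_rde_flow \<alpha> T X XX A \<phi>"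
    and "real_jordan_basis A js b"
    and "ds = block_sizes js"
    and "\<Delta> = block_subspaces ds b"
  shows "\<exists>\<xi>. cascade_decomposition \<Delta> T \<phi> \<xi> \<and>
    (\<forall>\<tau>\<in>{0..T}. \<forall>\<xi>'. cascade_decomposition \<Delta> \<tau> \<phi> \<xi>' \<longrightarrow>
       (\<forall>i<length ds. \<forall>t\<in>{0..\<tau>}. \<xi>' i t = \<xi> i t)) \<and>
    (\<forall>t\<in>{0..T}.
       (\<forall>i<length ds. linear (\<xi> i t) \<and>
          (\<forall>r<CARD('n). \<forall>c<CARD('n). r \<notin> block_rows ds i \<longrightarrow>
             matrix_in_basis b (\<xi> i t) $$ (r, c) = 1\<^sub>m CARD('n) $$ (r, c))) \<and>
       matrix_in_basis b (\<phi> t) =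
         foldr (*) (map (\<lambda>i. matrix_in_basis b (\<xi> i t)) [0..<length ds]) (1\<^sub>m CARD('n)))"
proof -
  let ?L = "endo_of ((*v) A)"
  let ?k = "length ds"
  from assms(6) have basis: "ordered_basis b"
    and jordan: "matrix_in_basis b ((*v) A) = real_jordan_matrix js"
    by (auto simp: real_jordan_basis_def)
  have sizes: "sum_list ds = CARD('n)"
    using arg_cong[OF jordan, of dim_row] \<open>ds = block_sizes js\<close>
    by (simp add: real_jordan_matrix_dim) (simp add: matrix_in_basis_def)
  let ?P = "\<lambda>i. basis_truncate b (block_start ds i)"
  have "projection_flag.flag_preserving ?P (endo_apply ?L)"
  proof (rule block_triangular_flag_preserving[OF basis sizes])
    show "matrix_in_basis b (endo_apply ?L) $$ (r, c) = 0"
      if "c < block_start ds i" "block_start ds i \<le> r" "r < CARD('n)" for i r c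
      using that real_jordan_matrix_upper_triangular[of c js i r] sizes
      by (simp add: jordan \<open>ds = block_sizes js\<close> real_jordan_matrix_dim)
  qed simp
  then interpret flag_invariant_operator ?P ?k ?L
    by (intro flag_invariant_operator.intro projection_flag_basis[OF basis sizes]
        flag_invariant_operator_axioms.intro)

  have \<phi>0: "\<phi> 0 = id" and sol: "\<And>x0. linear_rde_solution \<alpha> T X XX A (\<lambda>t. \<phi> t x0)"
    using assms(5) by (auto simp: linear_rde_flow_def)
  have \<phi>: "\<phi> t = flow (X t - X 0)" if "t \<in> {0..T}" for t
  proof
    fix x0
    show "\<phi> t x0 = flow (X t - X 0) x0"
      using linear_rde_solution_eq_exp[OF assms(2,4) sol that, of x0] by (simp add: \<phi>0)
  qed
  have iso: "flag_iso (\<phi> t)" if "t \<in> {0..T}" for t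
    using flow_iso \<phi>[OF that] by simp
  have \<Delta>: "length \<Delta> = ?k" "\<Delta> ! i = range (block_proj i)" if "i < ?k" for i
    using that range_block_proj_eq_span[OF basis sizes]
    by (simp_all add: \<open>\<Delta> = block_subspaces ds b\<close> block_subspaces_def)
  have length_\<Delta>: "length \<Delta> = ?k"
    by (simp add: \<open>\<Delta> = block_subspaces ds b\<close> block_subspaces_def)

  define \<xi> where "\<xi> = (\<lambda>i t. cascade_factor (\<phi> t) i)"
  have "cascade_decomposition \<Delta> T \<phi> \<xi>"
    unfolding cascade_decomposition_def length_\<Delta>
  proof (intro conjI allI impI ballI)
    show "\<xi> i 0 = id" for i by (simp add: \<xi>_def \<phi>0)
    show "\<xi> i t \<in> Diff (\<Delta> ! i)" if "t \<in> {0..T}" "i < ?k" for t i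
      using cascade_factor_flow_in_Diff that by (simp add: \<xi>_def \<phi> \<Delta>)
    show "\<phi> t = foldr (\<circ>) (map (\<lambda>i. \<xi> i t) [0..<?k]) id" if "t \<in> {0..T}" for t
      using compose_cascade_factors[OF iso[OF that]] by (simp add: \<xi>_def)
  qed
  moreover have "\<xi>' i t = \<xi> i t"
    if \<xi>': "cascade_decomposition \<Delta> \<tau> \<phi> \<xi>'" and \<tau>: "\<tau> \<in> {0..T}" and "i < ?k" and t: "t \<in> {0..\<tau>}"
    for \<tau> \<xi>' i t
    unfolding \<xi>_def
  proof (rule cascade_factor_unique)
    show "flag_iso (\<phi> t)" using \<tau> t by (intro iso) auto
    show "\<phi> t = foldr (\<circ>) (map (\<lambda>i. \<xi>' i t) [0..<?k]) id"
      using \<xi>' t by (simp add: cascade_decomposition_def length_\<Delta>)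
    show "\<xi>' j t x - x \<in> range (block_proj j)" if "j < ?k" for j x
    proof -
      \<comment> \<open>The block is the kernel of the projection on the other blocks.\<close>
      have "\<xi>' j t \<in> Diff {x. x - block_proj j x = 0}"
        using \<xi>' t that by (simp add: cascade_decomposition_def length_\<Delta> \<Delta> range_block_proj)
      then have "\<xi>' j t x - x - block_proj j (\<xi>' j t x - x) = 0"
        by (rule Diff_moves_in_kernel[rotated])
          (intro linear_compose_sub linear_block_proj linear_id[unfolded id_def])
      then show ?thesis by (simp only: range_block_proj mem_Collect_eq)
    qed
  qed fact
  moreover have "linear (\<xi> i t)" if "t \<in> {0..T}" for i t
    unfolding \<xi>_def by (rule linear_cascade_factor) (rule iso[OF that])
  moreover have "matrix_in_basis b (\<xi> i t) $$ (r, c) = 1\<^sub>m CARD('n) $$ (r, c)"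
    if t: "t \<in> {0..T}" and "i < ?k" and r: "r < CARD('n)" "r \<notin> block_rows ds i" and c: "c < CARD('n)"
    for i t r c
  proof -
    obtain w where "\<xi> i t (b c) - b c = block_proj i w"
      using cascade_factor_minus_id_in_block[OF iso[OF t], of i "b c"] by (auto simp: \<xi>_def)
    then have "basis_coord b r (\<xi> i t (b c)) - basis_coord b r (b c) = 0"
      using basis_coord_block_proj[OF basis sizes r(1), of i w] r(2)
      by (simp flip: linear_diff[OF linear_basis_coord[OF basis]])
    then show ?thesis
      using r c by (simp add: matrix_in_basis_index[OF basis] basis_coord_basis[OF basis])
  qed
  moreover have "matrix_in_basis b (\<phi> t) =
      foldr (*) (map (\<lambda>i. matrix_in_basis b (\<xi> i t)) [0..<?k]) (1\<^sub>m CARD('n))" if t: "t \<in> {0..T}" for t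
  proof -
    have "matrix_in_basis b (foldr (\<circ>) (map (cascade_factor (\<phi> t)) [0..<?k]) id) =
        foldr (*) (map (matrix_in_basis b) (map (cascade_factor (\<phi> t)) [0..<?k])) (1\<^sub>m CARD('n))"
      by (rule matrix_in_basis_foldr[OF basis]) (auto intro: linear_cascade_factor[OF iso[OF t]])
    then show ?thesis by (simp add: compose_cascade_factors[OF iso[OF t]] \<xi>_def o_def)
  qed
  ultimately show ?thesis
    by (intro exI[of _ \<xi>]) blast
qed

end
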